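(* Let $G$ be a finite group and $H<G$ a subgroup. Then $$\frac{1}{k(H)^{1/2}\,k(G)^{1/2}}\,[G:H]^{1/2}\;\le\; C(G,H)\;\le\;[G:H]^{1/2}.$$
   Context: For a finite group $G$, $\mathrm{Irr}(G)$ is the set of irreducible complex characters of $G$ and $k(G)=|\mathrm{Irr}(G)|$ is the number of conjugacy classes of $G$. For a subgroup $H<G$, $\rho\in\mathrm{Irr}(G)$ and $\pi\in\mathrm{Irr}(H)$, the induced multiplicity $c(\rho,\pi)$ is the multiplicity of $\rho$ in the induced character $\mathrm{Ind}_H^G\pi$, i.e. $\mathrm{Ind}_H^G\pi=\sum_{\rho\in\mathrm{Irr}(G)}c(\rho,\pi)\,\rho$ (equivalently, the multiplicity of $\pi$ in the restriction of $\rho$ to $H$). The largest induced multiplicity is $C(G,H)=\max_{\rho\in\mathrm{Irr}(G)}\max_{\pi\in\mathrm{Irr}(H)}c(\rho,\pi)$. *)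

theory Defs
  imports "HOL-Algebra.Group_Action" "Jordan_Normal_Form.VS_Connect"
begin

text \<open>
  Finite-dimensional complex representations are taken in matrix form, as homomorphisms into the
  group of units of the ring of complex \<open>n \<times> n\<close> matrices.  Since a finite-dimensional complex
  vector space has a basis and the trace does not depend on it, no character is lost.
\<close>

definition representation :: "('a, 'b) monoid_scheme \<Rightarrow> nat \<Rightarrow> ('a \<Rightarrow> complex mat) \<Rightarrow> bool"
  where "representation G n R \<longleftrightarrow> R \<in> hom G (units_of (ring_mat TYPE(complex) n ()))"

definition invariant_subspace ::
    "('a, 'b) monoid_scheme \<Rightarrow> nat \<Rightarrow> ('a \<Rightarrow> complex mat) \<Rightarrow> complex vec set \<Rightarrow> bool"
  where "invariant_subspace G n R W \<longleftrightarrow>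
    subspace (class_ring :: complex ring) W (module_vec TYPE(complex) n) \<and>
    (\<forall>g\<in>carrier G. \<forall>w\<in>W. R g *\<^sub>v w \<in> W)"

definition irreducible_representation ::
    "('a, 'b) monoid_scheme \<Rightarrow> nat \<Rightarrow> ('a \<Rightarrow> complex mat) \<Rightarrow> bool"
  where "irreducible_representation G n R \<longleftrightarrow>
    representation G n R \<and> n > 0 \<and>
    (\<forall>W. invariant_subspace G n R W \<longrightarrow> W = {0\<^sub>v n} \<or> W = carrier_vec n)"

definition mat_trace :: "complex mat \<Rightarrow> complex"
  where "mat_trace A = (\<Sum>i<dim_row A. A $$ (i, i))"

text \<open>
  Characters are restricted to the carrier (hence \<open>undefined\<close> outside it), so that equality of
  characters as HOL functions is equality of functions on the group.
\<close>

definition character :: "('a, 'b) monoid_scheme \<Rightarrow> ('a \<Rightarrow> complex mat) \<Rightarrow> 'a \<Rightarrow> complex"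
  where "character G R = (\<lambda>g\<in>carrier G. mat_trace (R g))"

definition Irr :: "('a, 'b) monoid_scheme \<Rightarrow> ('a \<Rightarrow> complex) set"
  where "Irr G = {character G R | n R. irreducible_representation G n R}"

definition class_number :: "('a, 'b) monoid_scheme \<Rightarrow> nat"
  where "class_number G =
    card (orbits G (carrier G) (\<lambda>g. \<lambda>x\<in>carrier G. g \<otimes>\<^bsub>G\<^esub> x \<otimes>\<^bsub>G\<^esub> inv\<^bsub>G\<^esub> g))"

definition induced_character ::
    "('a, 'b) monoid_scheme \<Rightarrow> 'a set \<Rightarrow> ('a \<Rightarrow> complex) \<Rightarrow> 'a \<Rightarrow> complex"
  where "induced_character G H \<pi> = (\<lambda>g\<in>carrier G.
    (\<Sum>x | x \<in> carrier G \<and> inv\<^bsub>G\<^esub> x \<otimes>\<^bsub>G\<^esub> g \<otimes>\<^bsub>G\<^esub> x \<in> H. \<pi> (inv\<^bsub>G\<^esub> x \<otimes>\<^bsub>G\<^esub> g \<otimes>\<^bsub>G\<^esub> x))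
      / of_nat (card H))"

text \<open>
  The multiplicities of the irreducible characters in a character \<open>\<psi>\<close> are the coefficients of the
  decomposition of \<open>\<psi>\<close>; they are natural numbers, and unique because the irreducible characters are
  linearly independent.
\<close>

definition multiplicities ::
    "('a, 'b) monoid_scheme \<Rightarrow> ('a \<Rightarrow> complex) \<Rightarrow> ('a \<Rightarrow> complex) \<Rightarrow> nat"
  where "multiplicities G \<psi> = (THE m. m \<in> extensional (Irr G) \<and>
    (\<forall>g\<in>carrier G. \<psi> g = (\<Sum>\<chi>\<in>Irr G. of_nat (m \<chi>) * \<chi> g)))"

definition induced_multiplicity ::
    "('a, 'b) monoid_scheme \<Rightarrow> 'a set \<Rightarrow> ('a \<Rightarrow> complex) \<Rightarrow> ('a \<Rightarrow> complex) \<Rightarrow> nat"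
  where "induced_multiplicity G H \<rho> \<pi> = multiplicities G (induced_character G H \<pi>) \<rho>"

definition largest_induced_multiplicity :: "('a, 'b) monoid_scheme \<Rightarrow> 'a set \<Rightarrow> nat"
  where "largest_induced_multiplicity G H =
    (MAX \<rho>\<in>Irr G. MAX \<pi>\<in>Irr (G\<lparr>carrier := H\<rparr>). induced_multiplicity G H \<rho> \<pi>)"

end

theory Submission
  imports Defs "HOL-Analysis.Convex" "Jordan_Normal_Form.Spectral_Radius"
begin

text \<open>
  Write \<open>c(\<rho>,\<pi>)\<close> for the induced multiplicity and \<open>d\<close> for degrees.  Evaluating \<open>Ind \<pi>\<close> at the identity gives
  \<open>\<Sum>\<^sub>\<rho> c(\<rho>,\<pi>) d(\<rho>) = [G:H] d(\<pi>)\<close>, and evaluating the restriction of \<open>\<rho>\<close> gives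
  \<open>d(\<rho>) = \<Sum>\<^sub>\<pi> c(\<rho>,\<pi>) d(\<pi>)\<close>.  Hence \<open>c(\<rho>,\<pi>) d(\<rho>) \<le> [G:H] d(\<pi>)\<close> and \<open>c(\<rho>,\<pi>) d(\<pi>) \<le> d(\<rho>)\<close>, whose product
  is the upper bound.  For the lower bound, multiply the first identity by \<open>d(\<pi>)\<close> and sum over \<open>\<pi>\<close>:
  \<open>[G:H] |H| \<le> C(G,H) (\<Sum>\<^sub>\<rho> d(\<rho>)) (\<Sum>\<^sub>\<pi> d(\<pi>))\<close>, and by Cauchy--Schwarz the two sums are at most
  \<open>(k(G) |G|)\<^sup>1\<^sup>/\<^sup>2\<close> and \<open>(k(H) |H|)\<^sup>1\<^sup>/\<^sup>2\<close>.  The character theory this needs is obtained from Schur's lemma, Maschke's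
  theorem and the regular representation.
\<close>

section \<open>Complex matrices\<close>

text \<open>The delicate point is that the same numbers \<open>c\<close> serve in both identities.
  They are defined by decomposing the induced character, but the formula for the degree of
  \<open>\<rho>\<close> needs them as coefficients of a restriction. Frobenius reciprocity supplies
  the link and also settles integrality: the inner product of \<open>\<pi>\<close> with a restricted
  character is a natural number by complete reducibility over \<open>H\<close>. Hence no induced
  representation is ever constructed; induction occurs only as a formula for class functions.

  The factor |H| in the lower bound is the sum of the squares of the degrees over \<open>H\<close>,
  that is, the regular character of \<open>H\<close> at the identity. Cauchy--Schwarz produces the
  number of irreducible characters, whereas \<open>class_number\<close> counts conjugacy classes, so
  orthogonality alone is not enough: the irreducible characters must also span the class
  functions.\<close>

lemma mat_trace_comm:
  assumes "A \<in> carrier_mat n m" "B \<in> carrier_mat m n"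
  shows "mat_trace (A * B) = mat_trace (B * A)"
proof -
  have "mat_trace (A * B) = (\<Sum>i<n. \<Sum>j<m. A $$ (i, j) * B $$ (j, i))"
    using assms by (auto simp: mat_trace_def scalar_prod_def lessThan_atLeast0 intro!: sum.cong)
  also have "\<dots> = (\<Sum>j<m. \<Sum>i<n. B $$ (j, i) * A $$ (i, j))"
    by (subst sum.swap) (simp add: mult.commute)
  also have "\<dots> = mat_trace (B * A)"
    using assms by (auto simp: mat_trace_def scalar_prod_def lessThan_atLeast0 intro!: sum.cong)
  finally show ?thesis .
qed

lemma mat_trace_add:
  assumes "A \<in> carrier_mat n n" "B \<in> carrier_mat n n"
  shows "mat_trace (A + B) = mat_trace A + mat_trace B"
  using assms by (simp add: mat_trace_def sum.distrib)

lemma mat_trace_smult: "A \<in> carrier_mat n n \<Longrightarrow> mat_trace (c \<cdot>\<^sub>m A) = c * mat_trace A"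
  by (auto simp: mat_trace_def sum_distrib_left)

lemma mat_trace_one [simp]: "mat_trace (1\<^sub>m n) = of_nat n"
  by (simp add: mat_trace_def)

text \<open>Matrices of all sizes share one type, so there is no common zero to start a sum from.
  The dimensions are therefore explicit arguments, and the empty sum is the zero matrix of that
  size.\<close>

definition mat_sum :: "nat \<Rightarrow> nat \<Rightarrow> ('i \<Rightarrow> complex mat) \<Rightarrow> 'i set \<Rightarrow> complex mat"
  where "mat_sum n m F I = mat n m (\<lambda>ij. \<Sum>k\<in>I. F k $$ ij)"

lemma mat_sum_carrier [simp]: "mat_sum n m F I \<in> carrier_mat n m"
  by (simp add: mat_sum_def)

lemma mat_sum_index: "i < n \<Longrightarrow> j < m \<Longrightarrow> mat_sum n m F I $$ (i, j) = (\<Sum>k\<in>I. F k $$ (i, j))"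
  by (simp add: mat_sum_def)

lemma mat_sum_cong: "(\<And>k. k \<in> I \<Longrightarrow> F k = F' k) \<Longrightarrow> mat_sum n m F I = mat_sum n m F' I"
  by (simp add: mat_sum_def)

lemma mat_sum_reindex: "bij_betw h I J \<Longrightarrow> mat_sum n m (\<lambda>k. F (h k)) I = mat_sum n m F J"
  unfolding mat_sum_def
  by (rule arg_cong[where f = "mat n m"], rule ext, rule sum.reindex_bij_betw)

lemma mult_mat_sum:
  assumes X: "X \<in> carrier_mat k n" and F: "\<And>i. i \<in> I \<Longrightarrow> F i \<in> carrier_mat n m"
  shows "X * mat_sum n m F I = mat_sum k m (\<lambda>i. X * F i) I"
proof (rule eq_matI)
  fix i j assume "i < dim_row (mat_sum k m (\<lambda>i. X * F i) I)" "j < dim_col (mat_sum k m (\<lambda>i. X * F i) I)"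
  then have ij: "i < k" "j < m" by (auto simp: mat_sum_def)
  have "(X * mat_sum n m F I) $$ (i, j) = (\<Sum>l<n. X $$ (i, l) * (\<Sum>a\<in>I. F a $$ (l, j)))"
    using X ij by (auto simp: mat_sum_def scalar_prod_def lessThan_atLeast0)
  also have "\<dots> = (\<Sum>a\<in>I. \<Sum>l<n. X $$ (i, l) * F a $$ (l, j))"
    by (subst sum.swap) (simp add: sum_distrib_left)
  also have "\<dots> = (\<Sum>a\<in>I. (X * F a) $$ (i, j))"
  proof (rule sum.cong)
    fix a assume "a \<in> I"
    from F[OF this] show "(\<Sum>l<n. X $$ (i, l) * F a $$ (l, j)) = (X * F a) $$ (i, j)"
      using X ij by (auto simp: scalar_prod_def lessThan_atLeast0)
  qed simp
  finally show "(X * mat_sum n m F I) $$ (i, j) = mat_sum k m (\<lambda>i. X * F i) I $$ (i, j)"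
    using ij by (simp add: mat_sum_index)
qed (use X in \<open>auto simp: mat_sum_def\<close>)

lemma mat_sum_mult:
  assumes X: "X \<in> carrier_mat m k" and F: "\<And>i. i \<in> I \<Longrightarrow> F i \<in> carrier_mat n m"
  shows "mat_sum n m F I * X = mat_sum n k (\<lambda>i. F i * X) I"
proof (rule eq_matI)
  fix i j assume "i < dim_row (mat_sum n k (\<lambda>i. F i * X) I)" "j < dim_col (mat_sum n k (\<lambda>i. F i * X) I)"
  then have ij: "i < n" "j < k" by (auto simp: mat_sum_def)
  have "(mat_sum n m F I * X) $$ (i, j) = (\<Sum>l<m. (\<Sum>a\<in>I. F a $$ (i, l)) * X $$ (l, j))"
    using X ij by (auto simp: mat_sum_def scalar_prod_def lessThan_atLeast0)
  also have "\<dots> = (\<Sum>a\<in>I. \<Sum>l<m. F a $$ (i, l) * X $$ (l, j))"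
    by (subst sum.swap) (simp add: sum_distrib_right)
  also have "\<dots> = (\<Sum>a\<in>I. (F a * X) $$ (i, j))"
  proof (rule sum.cong)
    fix a assume "a \<in> I"
    from F[OF this] show "(\<Sum>l<m. F a $$ (i, l) * X $$ (l, j)) = (F a * X) $$ (i, j)"
      using X ij by (auto simp: scalar_prod_def lessThan_atLeast0)
  qed simp
  finally show "(mat_sum n m F I * X) $$ (i, j) = mat_sum n k (\<lambda>i. F i * X) I $$ (i, j)"
    using ij by (simp add: mat_sum_index)
qed (use X in \<open>auto simp: mat_sum_def\<close>)

lemma mat_trace_mat_sum:
  assumes "\<And>i. i \<in> I \<Longrightarrow> F i \<in> carrier_mat n n"
  shows "mat_trace (mat_sum n n F I) = (\<Sum>i\<in>I. mat_trace (F i))"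
proof -
  have "mat_trace (mat_sum n n F I) = (\<Sum>j<n. \<Sum>i\<in>I. F i $$ (j, j))"
    by (simp add: mat_trace_def mat_sum_def)
  also have "\<dots> = (\<Sum>i\<in>I. \<Sum>j<n. F i $$ (j, j))"
    by (rule sum.swap)
  also have "\<dots> = (\<Sum>i\<in>I. mat_trace (F i))"
    using assms by (auto intro!: sum.cong simp: mat_trace_def)
  finally show ?thesis .
qed

definition unit_mat :: "nat \<Rightarrow> nat \<Rightarrow> nat \<Rightarrow> nat \<Rightarrow> complex mat"
  where "unit_mat n m i j = mat n m (\<lambda>(a, b). if a = i \<and> b = j then 1 else 0)"

lemma unit_mat_carrier [simp]: "unit_mat n m i j \<in> carrier_mat n m"
  by (simp add: unit_mat_def)

text \<open>Matrix units turn a product of one coefficient of \<open>X\<close> and one of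
  \<open>Y\<close> into a single entry. With \<open>k = i\<close> and \<open>l = j\<close> this
  gives the products of diagonal entries that make up a product of two traces.\<close>

lemma mult_unit_mat_mult_index:
  assumes "X \<in> carrier_mat n n" "Y \<in> carrier_mat m m" "i < n" "j < m" "k < n" "l < m"
  shows "(X * unit_mat n m i j * Y) $$ (k, l) = X $$ (k, i) * Y $$ (j, l)"
proof -
  have 1: "(X * unit_mat n m i j) $$ (k, b) = (if b = j then X $$ (k, i) else 0)" if "b < m" for b
  proof -
    have "(X * unit_mat n m i j) $$ (k, b) = (\<Sum>a<n. X $$ (k, a) * (if a = i \<and> b = j then 1 else 0))"
      using assms that by (auto simp: unit_mat_def scalar_prod_def lessThan_atLeast0)
    also have "\<dots> = (\<Sum>a<n. if a = i then (if b = j then X $$ (k, i) else 0) else 0)"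
      by (rule sum.cong) auto
    finally show ?thesis using assms by simp
  qed
  have "(X * unit_mat n m i j * Y) $$ (k, l) = (\<Sum>b<m. (X * unit_mat n m i j) $$ (k, b) * Y $$ (b, l))"
    using assms by (auto simp: unit_mat_def scalar_prod_def lessThan_atLeast0)
  also have "\<dots> = (\<Sum>b<m. if b = j then X $$ (k, i) * Y $$ (j, l) else 0)"
    by (rule sum.cong) (auto simp: 1)
  finally show ?thesis using assms by simp
qed

section \<open>Subspaces described by matrices\<close>

lemma mat_eq_if_mult_vec_eq:
  fixes A B :: "complex mat"
  assumes A: "A \<in> carrier_mat n m" and B: "B \<in> carrier_mat n m"
    and eq: "\<And>v. v \<in> carrier_vec m \<Longrightarrow> A *\<^sub>v v = B *\<^sub>v v"
  shows "A = B"
proof (rule eq_matI)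
  fix i j assume "i < dim_row B" "j < dim_col B"
  then have ij: "i < n" "j < m" using B by auto
  have "A *\<^sub>v unit_vec m j = B *\<^sub>v unit_vec m j" by (rule eq) simp
  then have "(A *\<^sub>v unit_vec m j) $ i = (B *\<^sub>v unit_vec m j) $ i" by simp
  then show "A $$ (i, j) = B $$ (i, j)"
    using A B ij by simp
qed (use A B in auto)

text \<open>If \<open>n < r\<close>, padding \<open>B\<close> with zero rows and \<open>C\<close>
  with zero columns makes both square without changing the product \<open>C * B\<close>. A left
  inverse of a square matrix is also a right inverse, but row \<open>n\<close> of the padded
  \<open>B\<close> is zero.\<close>

lemma mat_left_inverse_imp_le:
  fixes B C :: "complex mat"
  assumes B: "B \<in> carrier_mat n r" and C: "C \<in> carrier_mat r n" and CB: "C * B = 1\<^sub>m r"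
  shows "r \<le> n"
proof (rule ccontr)
  assume "\<not> r \<le> n"
  then have nr: "n < r" by simp
  define B' where "B' = mat r r (\<lambda>(i, j). if i < n then B $$ (i, j) else 0)"
  define C' where "C' = mat r r (\<lambda>(i, j). if j < n then C $$ (i, j) else 0)"
  have B': "B' \<in> carrier_mat r r" and C': "C' \<in> carrier_mat r r" by (auto simp: B'_def C'_def)
  have "C' * B' = C * B"
  proof (rule eq_matI)
    fix i j assume "i < dim_row (C * B)" "j < dim_col (C * B)"
    then have ij: "i < r" "j < r" using B C by auto
    have "(C' * B') $$ (i, j) = (\<Sum>k<r. if k < n then C $$ (i, k) * B $$ (k, j) else 0)"
      using ij by (auto simp: B'_def C'_def scalar_prod_def lessThan_atLeast0 intro!: sum.cong)
    also have "\<dots> = (\<Sum>k<n. C $$ (i, k) * B $$ (k, j))"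
      using nr by (intro sum.mono_neutral_cong_right) auto
    also have "\<dots> = (C * B) $$ (i, j)"
      using ij B C by (auto simp: scalar_prod_def lessThan_atLeast0)
    finally show "(C' * B') $$ (i, j) = (C * B) $$ (i, j)" .
  qed (use B C B' C' in auto)
  then have "B' * C' = 1\<^sub>m r"
    using mat_mult_left_right_inverse[OF C' B'] CB by simp
  then have "(B' * C') $$ (n, n) = 1" using nr by simp
  moreover have "(B' * C') $$ (n, n) = 0"
    using nr by (simp add: B'_def C'_def scalar_prod_def)
  ultimately show False by simp
qed

lemma subspace_vec_iff:
  "VectorSpace.subspace (class_ring :: complex ring) W (module_vec TYPE(complex) n) \<longleftrightarrow>
    W \<subseteq> carrier_vec n \<and> 0\<^sub>v n \<in> W \<and> (\<forall>v\<in>W. \<forall>w\<in>W. v + w \<in> W) \<and> (\<forall>c. \<forall>w\<in>W. c \<cdot>\<^sub>v w \<in> W)"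
proof -
  have "submodule (class_ring :: complex ring) W (module_vec TYPE(complex) n) \<longleftrightarrow>
    W \<subseteq> carrier_vec n \<and> 0\<^sub>v n \<in> W \<and> (\<forall>v\<in>W. \<forall>w\<in>W. v + w \<in> W) \<and> (\<forall>c. \<forall>w\<in>W. c \<cdot>\<^sub>v w \<in> W)"
    using vec_module[where ?'a = complex]
    unfolding submodule_def by (auto simp: module_vec_simps class_ring_simps)
  then show ?thesis
    unfolding VectorSpace.subspace_def using vec_vs[where ?'a = complex] by auto
qed

lemma mult_mat_vec_zero: "A \<in> carrier_mat n m \<Longrightarrow> A *\<^sub>v 0\<^sub>v m = (0\<^sub>v n :: complex vec)"
  by (intro eq_vecI) auto

lemma mult_vec_extend_cols:
  fixes B :: "complex mat"
  assumes B: "B \<in> carrier_mat n r" and w: "w \<in> carrier_vec n" and v: "v \<in> carrier_vec (Suc r)"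
  shows "mat_of_cols n (cols B @ [w]) *\<^sub>v v = B *\<^sub>v vec_first v r + v $ r \<cdot>\<^sub>v w"
proof (rule eq_vecI)
  fix i assume "i < dim_vec (B *\<^sub>v vec_first v r + v $ r \<cdot>\<^sub>v w)"
  then have i: "i < n" using w by auto
  have "(mat_of_cols n (cols B @ [w]) *\<^sub>v v) $ i
      = (\<Sum>j<Suc r. (cols B @ [w]) ! j $ i * v $ j)"
    using i B v by (auto simp: scalar_prod_def lessThan_atLeast0 mat_of_cols_def intro!: sum.cong)
  also have "\<dots> = (\<Sum>j<r. B $$ (i, j) * v $ j) + v $ r * w $ i"
    using i B by (auto simp: nth_append intro!: sum.cong)
  also have "\<dots> = (B *\<^sub>v vec_first v r + v $ r \<cdot>\<^sub>v w) $ i"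
    using i B w v by (auto simp: scalar_prod_def lessThan_atLeast0 vec_first_def)
  finally show "(mat_of_cols n (cols B @ [w]) *\<^sub>v v) $ i = (B *\<^sub>v vec_first v r + v $ r \<cdot>\<^sub>v w) $ i" .
qed (use w in auto)

text \<open>
  The columns of \<open>B\<close> are a basis of \<open>W\<close>, and \<open>B C\<close> is a projection onto \<open>W\<close>.  A pair with \<open>r\<close> maximal works:
  a vector of \<open>W\<close> outside the range of \<open>B\<close> would give a further column.
\<close>

lemma subspace_vec_basis_matrix:
  fixes W :: "complex vec set"
  assumes W: "VectorSpace.subspace (class_ring :: complex ring) W (module_vec TYPE(complex) n)"
  obtains r B C where "B \<in> carrier_mat n r" "C \<in> carrier_mat r n" "C * B = 1\<^sub>m r"
    "\<And>v. v \<in> carrier_vec r \<Longrightarrow> B *\<^sub>v v \<in> W" "\<And>w. w \<in> W \<Longrightarrow> B *\<^sub>v (C *\<^sub>v w) = w"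
proof -
  from W have sub: "W \<subseteq> carrier_vec n" and zero: "0\<^sub>v n \<in> W"
    and add: "\<And>v w. v \<in> W \<Longrightarrow> w \<in> W \<Longrightarrow> v + w \<in> W"
    and smult: "\<And>c w. w \<in> W \<Longrightarrow> c \<cdot>\<^sub>v w \<in> W"
    by (auto simp: subspace_vec_iff)
  define Q where "Q = (\<lambda>r. \<exists>B C. B \<in> carrier_mat n r \<and> C \<in> carrier_mat r n \<and> C * B = 1\<^sub>m r \<and>
    (\<forall>v\<in>carrier_vec r. B *\<^sub>v v \<in> W))"
  have "Q 0"
    unfolding Q_def
  proof (intro exI conjI ballI)
    show "0\<^sub>m n 0 *\<^sub>v v \<in> W" if "v \<in> carrier_vec 0" for v
    proof -
      have "0\<^sub>m n 0 *\<^sub>v v = 0\<^sub>v n" using that by (intro eq_vecI) (auto simp: scalar_prod_def)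
      then show ?thesis using zero by simp
    qed
  qed (auto intro: eq_matI)
  moreover have "\<And>r. Q r \<Longrightarrow> r \<le> n"
    unfolding Q_def using mat_left_inverse_imp_le by blast
  ultimately obtain r where r: "Q r" "\<And>r'. Q r' \<Longrightarrow> r' \<le> r"
    using GreatestI_nat[of Q] Greatest_le_nat[of Q] by metis
  from r(1) obtain B C where B: "B \<in> carrier_mat n r" and C: "C \<in> carrier_mat r n"
    and CB: "C * B = 1\<^sub>m r" and BW: "\<And>v. v \<in> carrier_vec r \<Longrightarrow> B *\<^sub>v v \<in> W"
    unfolding Q_def by blast
  have "B *\<^sub>v (C *\<^sub>v w) = w" if w: "w \<in> W" for w
  proof (rule ccontr)
    assume neq: "B *\<^sub>v (C *\<^sub>v w) \<noteq> w"
    have wn: "w \<in> carrier_vec n" using w sub by auto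
    \<comment> \<open>The part of \<open>w\<close> missed by \<open>B * C\<close>. It stays in
      \<open>W\<close>, is nonzero, and is killed by \<open>C\<close> because \<open>C * B\<close>
      is the identity.\<close>
    define u where "u = w + (-1) \<cdot>\<^sub>v (B *\<^sub>v (C *\<^sub>v w))"
    have u: "u \<in> W" unfolding u_def using w wn C by (intro add smult BW) auto
    then have un: "u \<in> carrier_vec n" using sub by auto
    have Cu: "C *\<^sub>v u = 0\<^sub>v r"
    proof -
      have "C *\<^sub>v u = C *\<^sub>v w + (-1) \<cdot>\<^sub>v (C *\<^sub>v (B *\<^sub>v (C *\<^sub>v w)))"
        unfolding u_def using B C wn
        by (subst mult_add_distrib_mat_vec[of _ r n]) (auto simp: mult_mat_vec[of _ r n])
      also have "C *\<^sub>v (B *\<^sub>v (C *\<^sub>v w)) = C *\<^sub>v w"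
        using B C wn CB by (subst assoc_mult_mat_vec[symmetric, of _ r n _ r]) auto
      also have "C *\<^sub>v w + (-1) \<cdot>\<^sub>v (C *\<^sub>v w) = 0\<^sub>v r"
        using C wn by (intro eq_vecI) auto
      finally show ?thesis .
    qed
    have "\<exists>i<n. u $ i \<noteq> 0"
    proof (rule ccontr)
      assume *: "\<not> (\<exists>i<n. u $ i \<noteq> 0)"
      have "w = B *\<^sub>v (C *\<^sub>v w)"
      proof (rule eq_vecI)
        fix i assume "i < dim_vec (B *\<^sub>v (C *\<^sub>v w))"
        then have i: "i < n" using B by auto
        then have "u $ i = 0" using * by auto
        then show "w $ i = (B *\<^sub>v (C *\<^sub>v w)) $ i" using i B C wn by (simp add: u_def)
      qed (use B wn in auto)
      then show False using neq by simp
    qed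
    then obtain i where i: "i < n" "u $ i \<noteq> 0" by auto
    \<comment> \<open>\<open>D\<close> reads off a nonzero coordinate of \<open>u\<close>, scaled so
      that \<open>D\<close> takes the value 1 at \<open>u\<close>. Subtracting
      \<open>D * B * C\<close> makes the functional vanish on the columns of \<open>B\<close>; its
      value at \<open>u\<close> survives because \<open>C\<close> kills \<open>u\<close>. So
      \<open>u\<close> and \<open>D'\<close> extend \<open>B\<close> and \<open>C\<close> by one
      column and one row.\<close>
    define D where "D = mat 1 n (\<lambda>(a, b). if b = i then 1 / u $ i else 0)"
    define D' where "D' = D - D * B * C"
    have D: "D \<in> carrier_mat 1 n" by (simp add: D_def)
    have D': "D' \<in> carrier_mat 1 n" using D B C by (auto simp: D'_def)
    have "D' * B = D * B - D * B * C * B"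
      unfolding D'_def using D B C by (intro minus_mult_distrib_mat) auto
    also have "D * B * C * B = D * B * (C * B)"
      using D B C by (intro assoc_mult_mat[of _ 1 r _ n _ r]) auto
    also have "\<dots> = D * B" unfolding CB using D B by simp
    finally have D'B: "D' * B = 0\<^sub>m 1 r" using D B by simp
    have "D' *\<^sub>v u = D *\<^sub>v u - (D * B * C) *\<^sub>v u"
      unfolding D'_def using D B C un by (intro minus_mult_distrib_mat_vec) auto
    also have "(D * B * C) *\<^sub>v u = (D * B) *\<^sub>v (C *\<^sub>v u)"
      using D B C un by (intro assoc_mult_mat_vec) auto
    also have "D *\<^sub>v u - (D * B) *\<^sub>v (C *\<^sub>v u) = D *\<^sub>v u" 
      unfolding Cu using mult_mat_vec_zero[of "D * B" 1 r] D B un by simp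
    finally have "(D' *\<^sub>v u) $ 0 = (D *\<^sub>v u) $ 0" by simp
    also have "\<dots> = (\<Sum>b<n. (if b = i then 1 / u $ i else 0) * u $ b)"
      using un by (auto simp: D_def scalar_prod_def lessThan_atLeast0)
    also have "\<dots> = (\<Sum>b<n. if b = i then 1 else 0)"
      using i by (intro sum.cong) auto
    also have "\<dots> = 1" using i by simp
    finally have D'u: "row D' 0 \<bullet> u = 1" using D' un by simp
    define B' where "B' = mat_of_cols n (cols B @ [u])"
    define C' where "C' = mat_of_rows n (rows C @ [row D' 0])"
    have B': "B' \<in> carrier_mat n (Suc r)" and C': "C' \<in> carrier_mat (Suc r) n"
      using B C by (auto simp: B'_def C'_def)
    have colB': "col B' j = (if j < r then col B j else u)" if "j < Suc r" for j
      using that B un unfolding B'_def by (subst col_mat_of_cols) (auto simp: nth_append)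
    have rowC': "row C' j = (if j < r then row C j else row D' 0)" if "j < Suc r" for j
      using that C D' unfolding C'_def
      by (subst mat_of_rows_row) (auto simp: nth_append)
    have "C' * B' = 1\<^sub>m (Suc r)"
    proof (rule eq_matI)
      fix a b assume "a < dim_row (1\<^sub>m (Suc r))" "b < dim_col (1\<^sub>m (Suc r))"
      then have ab: "a < Suc r" "b < Suc r" by auto
      have 1: "row C a \<bullet> col B b = (if a = b then 1 else 0)" if "a < r" "b < r" for a b
        using arg_cong[OF CB, of "\<lambda>M. M $$ (a, b)"] B C that by simp
      have 2: "row C a \<bullet> u = 0" if "a < r"
        using arg_cong[OF Cu, of "\<lambda>v. v $ a"] C that by simp
      have 3: "row D' 0 \<bullet> col B b = 0" if "b < r"
        using arg_cong[OF D'B, of "\<lambda>M. M $$ (0, b)"] B D' that by simp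
      show "(C' * B') $$ (a, b) = 1\<^sub>m (Suc r) $$ (a, b)"
        using ab B' C' 1 2 3 D'u by (auto simp: colB' rowC')
    qed (use B' C' in auto)
    moreover have "B' *\<^sub>v v \<in> W" if "v \<in> carrier_vec (Suc r)" for v
      unfolding B'_def mult_vec_extend_cols[OF B un that]
      using u by (intro add smult BW) auto
    ultimately have "Q (Suc r)" unfolding Q_def using B' C' by blast
    then show False using r(2) by fastforce
  qed
  with that[OF B C CB BW] show ?thesis by blast
qed

section \<open>Schur's lemma and Maschke's theorem\<close>

text \<open>Invertibility need not be listed on the right: \<open>R (inv g)\<close> is a two-sided
  inverse of \<open>R g\<close>.\<close>

lemma representation_iff:
  assumes "group G"
  shows "representation G n R \<longleftrightarrow> (\<forall>g\<in>carrier G. R g \<in> carrier_mat n n) \<and>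
    (\<forall>g\<in>carrier G. \<forall>h\<in>carrier G. R (g \<otimes>\<^bsub>G\<^esub> h) = R g * R h) \<and> R \<one>\<^bsub>G\<^esub> = 1\<^sub>m n"
    (is "_ \<longleftrightarrow> ?rhs")
proof
  interpret group G by fact
  let ?M = "ring_mat TYPE(complex) n ()"
  interpret M: ring ?M by (rule ring_mat)
  assume rep: "representation G n R"
  then have "R \<in> hom G (units_of ?M)" by (simp add: representation_def)
  from hom_one[OF this is_group M.units_group]
  have "R \<one>\<^bsub>G\<^esub> = 1\<^sub>m n" by (simp add: units_of_one ring_mat_simps)
  with rep show ?rhs
    by (auto simp: representation_def hom_def units_of_def Units_def ring_mat_simps Pi_def)
next
  interpret group G by fact
  assume R: ?rhs
  have "R g \<in> Units (ring_mat TYPE(complex) n ())" if g: "g \<in> carrier G" for g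
  proof -
    have "R (inv\<^bsub>G\<^esub> g) * R g = 1\<^sub>m n" "R g * R (inv\<^bsub>G\<^esub> g) = 1\<^sub>m n"
      using R g by (metis inv_closed l_inv, metis inv_closed r_inv)
    then show ?thesis
      using R g by (auto simp: Units_def ring_mat_simps intro!: bexI[of _ "R (inv\<^bsub>G\<^esub> g)"])
  qed
  then show "representation G n R"
    using R by (auto simp: representation_def hom_def units_of_def ring_mat_simps)
qed

section \<open>Intertwiners and Schur's lemma\<close>

text \<open>The equation \<open>R g * A = A * S g\<close> moves the action past \<open>A\<close>, so
  the image of \<open>A\<close> is stable under \<open>R\<close> and, in the next lemma, its kernel
  under \<open>S\<close>. The image is used again with \<open>S = R\<close>, for projections that
  commute with the action.\<close>

lemma invariant_subspace_mult_vec_range: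
  assumes A: "A \<in> carrier_mat n m" and S: "\<And>g. g \<in> carrier G \<Longrightarrow> S g \<in> carrier_mat m m"
    and R: "\<And>g. g \<in> carrier G \<Longrightarrow> R g \<in> carrier_mat n n"
    and RA: "\<And>g. g \<in> carrier G \<Longrightarrow> R g * A = A * S g"
  shows "invariant_subspace G n R ((*\<^sub>v) A ` carrier_vec m)"
  unfolding invariant_subspace_def
proof (intro conjI ballI)
  show "VectorSpace.subspace (class_ring :: complex ring) ((*\<^sub>v) A ` carrier_vec m) (module_vec TYPE(complex) n)"
    unfolding subspace_vec_iff
  proof (intro conjI ballI allI)
    show "(*\<^sub>v) A ` carrier_vec m \<subseteq> carrier_vec n" using A by auto
    have "A *\<^sub>v 0\<^sub>v m = 0\<^sub>v n" using A by (intro eq_vecI) auto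
    then show "0\<^sub>v n \<in> (*\<^sub>v) A ` carrier_vec m" by (metis imageI zero_carrier_vec)
  next
    fix v w assume "v \<in> (*\<^sub>v) A ` carrier_vec m" "w \<in> (*\<^sub>v) A ` carrier_vec m"
    then obtain x y where "x \<in> carrier_vec m" "v = A *\<^sub>v x" "y \<in> carrier_vec m" "w = A *\<^sub>v y" by auto
    then show "v + w \<in> (*\<^sub>v) A ` carrier_vec m"
      using A by (auto simp flip: mult_add_distrib_mat_vec)
  next
    fix c v assume "v \<in> (*\<^sub>v) A ` carrier_vec m"
    then obtain x where "x \<in> carrier_vec m" "v = A *\<^sub>v x" by auto
    then show "c \<cdot>\<^sub>v v \<in> (*\<^sub>v) A ` carrier_vec m"
      using A by (auto simp flip: mult_mat_vec)
  qed
next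
  fix g w assume g: "g \<in> carrier G" and "w \<in> (*\<^sub>v) A ` carrier_vec m"
  then obtain x where x: "x \<in> carrier_vec m" "w = A *\<^sub>v x" by auto
  have "R g *\<^sub>v w = (R g * A) *\<^sub>v x"
    using x A R[OF g] by simp
  also have "\<dots> = A *\<^sub>v (S g *\<^sub>v x)"
    unfolding RA[OF g] using x A S[OF g] by (intro assoc_mult_mat_vec) auto
  finally show "R g *\<^sub>v w \<in> (*\<^sub>v) A ` carrier_vec m"
    using S[OF g] x by auto
qed

lemma invariant_subspace_mult_vec_kernel:
  assumes A: "A \<in> carrier_mat n m" and S: "\<And>g. g \<in> carrier G \<Longrightarrow> S g \<in> carrier_mat m m"
    and R: "\<And>g. g \<in> carrier G \<Longrightarrow> R g \<in> carrier_mat n n"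
    and RA: "\<And>g. g \<in> carrier G \<Longrightarrow> R g * A = A * S g"
  shows "invariant_subspace G m S {v \<in> carrier_vec m. A *\<^sub>v v = 0\<^sub>v n}"
  unfolding invariant_subspace_def
proof (intro conjI ballI)
  have "A *\<^sub>v 0\<^sub>v m = 0\<^sub>v n" using A by (intro eq_vecI) auto
  then show "VectorSpace.subspace (class_ring :: complex ring) {v \<in> carrier_vec m. A *\<^sub>v v = 0\<^sub>v n} (module_vec TYPE(complex) m)"
    unfolding subspace_vec_iff using A
    by (auto simp: mult_add_distrib_mat_vec mult_mat_vec)
next
  fix g w assume g: "g \<in> carrier G" and "w \<in> {v \<in> carrier_vec m. A *\<^sub>v v = 0\<^sub>v n}"
  then have w: "w \<in> carrier_vec m" "A *\<^sub>v w = 0\<^sub>v n" by auto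
  have "A *\<^sub>v (S g *\<^sub>v w) = (A * S g) *\<^sub>v w"
    using w A S[OF g] by simp
  also have "\<dots> = R g *\<^sub>v (A *\<^sub>v w)"
    unfolding RA[OF g, symmetric] using w A R[OF g] by (intro assoc_mult_mat_vec) auto
  also have "\<dots> = 0\<^sub>v n" unfolding w using R[OF g] by (intro eq_vecI) auto
  finally show "S g *\<^sub>v w \<in> {v \<in> carrier_vec m. A *\<^sub>v v = 0\<^sub>v n}"
    using w S[OF g] by auto
qed

lemma mat_surj_imp_right_inverse:
  fixes A :: "complex mat"
  assumes A: "A \<in> carrier_mat n m" and surj: "(*\<^sub>v) A ` carrier_vec m = carrier_vec n"
  obtains B where "B \<in> carrier_mat m n" "A * B = 1\<^sub>m n"
proof -
  have "\<forall>j. \<exists>v. j < n \<longrightarrow> v \<in> carrier_vec m \<and> A *\<^sub>v v = unit_vec n j"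
    using surj by (metis imageE unit_vec_carrier)
  then obtain f where f: "\<And>j. j < n \<Longrightarrow> f j \<in> carrier_vec m \<and> A *\<^sub>v f j = unit_vec n j"
    by metis
  define B where "B = mat m n (\<lambda>(i, j). f j $ i)"
  have B: "B \<in> carrier_mat m n" by (simp add: B_def)
  have "A * B = 1\<^sub>m n"
  proof (rule eq_matI)
    fix i j assume "i < dim_row (1\<^sub>m n)" "j < dim_col (1\<^sub>m n)"
    then have ij: "i < n" "j < n" by auto
    have "col B j = f j" using f[OF ij(2)] ij by (intro eq_vecI) (auto simp: B_def)
    then have "(A * B) $$ (i, j) = (A *\<^sub>v f j) $ i" using A B ij by simp
    then show "(A * B) $$ (i, j) = 1\<^sub>m n $$ (i, j)" using f[OF ij(2)] ij by simp
  qed (use A B in auto)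
  with B that show ?thesis by blast
qed

text \<open>The image and kernel of \<open>A\<close> are invariant, hence trivial or everything. As
  \<open>A\<close> is nonzero, it is onto and has trivial kernel.\<close>

lemma schur_intertwiner:
  assumes G: "group G" and R: "irreducible_representation G n R" and S: "irreducible_representation G m S"
    and A: "A \<in> carrier_mat n m" and RA: "\<And>g. g \<in> carrier G \<Longrightarrow> R g * A = A * S g"
    and nz: "A \<noteq> 0\<^sub>m n m"
  obtains B where "B \<in> carrier_mat m n" "A * B = 1\<^sub>m n" "B * A = 1\<^sub>m m"
proof -
  have Rc: "\<And>g. g \<in> carrier G \<Longrightarrow> R g \<in> carrier_mat n n"
    and Sc: "\<And>g. g \<in> carrier G \<Longrightarrow> S g \<in> carrier_mat m m"
    using R S G by (auto simp: irreducible_representation_def representation_iff)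
  have range: "(*\<^sub>v) A ` carrier_vec m = {0\<^sub>v n} \<or> (*\<^sub>v) A ` carrier_vec m = carrier_vec n"
    using invariant_subspace_mult_vec_range[where G = G and R = R, OF A Sc Rc RA] R
    by (auto simp: irreducible_representation_def)
  have ker: "{v \<in> carrier_vec m. A *\<^sub>v v = 0\<^sub>v n} = {0\<^sub>v m} \<or> {v \<in> carrier_vec m. A *\<^sub>v v = 0\<^sub>v n} = carrier_vec m"
    using invariant_subspace_mult_vec_kernel[where G = G and S = S, OF A Sc Rc RA] S
    by (auto simp: irreducible_representation_def)
  have zero_if: "A = 0\<^sub>m n m" if "\<And>v. v \<in> carrier_vec m \<Longrightarrow> A *\<^sub>v v = 0\<^sub>v n"
  proof (rule mat_eq_if_mult_vec_eq[OF A])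
    show "A *\<^sub>v v = 0\<^sub>m n m *\<^sub>v v" if "v \<in> carrier_vec m" for v
      using that \<open>\<And>v. v \<in> carrier_vec m \<Longrightarrow> A *\<^sub>v v = 0\<^sub>v n\<close> by auto
  qed simp
  have ne: "\<not> (\<forall>v\<in>carrier_vec m. A *\<^sub>v v = 0\<^sub>v n)" using zero_if nz by blast
  have surj: "(*\<^sub>v) A ` carrier_vec m = carrier_vec n"
    using range ne by blast
  have inj: "v = 0\<^sub>v m" if "v \<in> carrier_vec m" "A *\<^sub>v v = 0\<^sub>v n" for v
    using ker ne that by blast
  obtain B where B: "B \<in> carrier_mat m n" and AB: "A * B = 1\<^sub>m n"
    using mat_surj_imp_right_inverse[OF A surj] .
  \<comment> \<open>The equality of \<open>m\<close> and \<open>n\<close> is not known here, so the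
    right inverse cannot be reversed by the result for square matrices. Instead, \<open>A\<close>
    kills \<open>B *\<^sub>v (A *\<^sub>v v) - v\<close>, and its kernel is trivial.\<close>
  have "B * A = 1\<^sub>m m"
  proof (rule mat_eq_if_mult_vec_eq)
    fix v :: "complex vec" assume v: "v \<in> carrier_vec m"
    let ?x = "B *\<^sub>v (A *\<^sub>v v) - v"
    have x: "?x \<in> carrier_vec m" using v A B by auto
    have "A *\<^sub>v ?x = A *\<^sub>v (B *\<^sub>v (A *\<^sub>v v)) - A *\<^sub>v v"
      using A B v by (intro mult_minus_distrib_mat_vec) auto
    also have "A *\<^sub>v (B *\<^sub>v (A *\<^sub>v v)) = (A * B) *\<^sub>v (A *\<^sub>v v)"
      using A B v by (intro assoc_mult_mat_vec[symmetric]) auto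
    also have "\<dots> = A *\<^sub>v v" unfolding AB using A v by auto
    also have "A *\<^sub>v v - A *\<^sub>v v = 0\<^sub>v n" using A v by auto
    finally have "?x = 0\<^sub>v m" by (rule inj[OF x])
    then have "(B *\<^sub>v (A *\<^sub>v v) - v) $ i = 0" if "i < m" for i using that by simp
    then have "B *\<^sub>v (A *\<^sub>v v) = v" using A B v by (intro eq_vecI) auto
    then show "(B * A) *\<^sub>v v = 1\<^sub>m m *\<^sub>v v" using A B v by simp
  qed (use A B in auto)
  with that B AB show ?thesis by blast
qed

text \<open>Over the complex numbers \<open>A\<close> has an eigenvalue \<open>k\<close> since
  \<open>n > 0\<close>. Then \<open>A\<close> minus \<open>k\<close> times the identity still
  intertwines but kills an eigenvector, so it is not invertible and must vanish. The scalar is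
  written through the trace because that is what the applications can compute.\<close>

lemma schur_scalar:
  assumes G: "group G" and R: "irreducible_representation G n R"
    and A: "A \<in> carrier_mat n n" and RA: "\<And>g. g \<in> carrier G \<Longrightarrow> R g * A = A * R g"
  shows "A = (mat_trace A / of_nat n) \<cdot>\<^sub>m 1\<^sub>m n"
proof -
  have n: "n > 0" and Rc: "\<And>g. g \<in> carrier G \<Longrightarrow> R g \<in> carrier_mat n n"
    using R G by (auto simp: irreducible_representation_def representation_iff)
  from spectrum_non_empty[OF A n] obtain k v where "eigenvector A v k"
    by (auto simp: spectrum_def eigenvalue_def)
  then have v: "v \<in> carrier_vec n" "v \<noteq> 0\<^sub>v n" "A *\<^sub>v v = k \<cdot>\<^sub>v v"
    using A by (auto simp: eigenvector_def)
  define A' where "A' = A - k \<cdot>\<^sub>m 1\<^sub>m n"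
  have A': "A' \<in> carrier_mat n n" unfolding A'_def by (rule minus_carrier_mat) simp
  have RA': "R g * A' = A' * R g" if g: "g \<in> carrier G" for g
  proof -
    have "R g * A' = R g * A - k \<cdot>\<^sub>m R g"
      unfolding A'_def using A Rc[OF g]
      by (subst mult_minus_distrib_mat[of _ n n]) (auto simp: mult_smult_distrib[of _ n n])
    moreover have "A' * R g = A * R g - k \<cdot>\<^sub>m R g"
      unfolding A'_def using A Rc[OF g]
      by (subst minus_mult_distrib_mat[of _ n n]) (auto simp: mult_smult_assoc_mat[of _ n n])
    ultimately show ?thesis using RA[OF g] by simp
  qed
  have A'v: "A' *\<^sub>v v = 0\<^sub>v n"
  proof -
    have "A' *\<^sub>v v = A *\<^sub>v v - k \<cdot>\<^sub>m 1\<^sub>m n *\<^sub>v v"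
      unfolding A'_def using A v by (intro minus_mult_distrib_mat_vec) auto
    also have "k \<cdot>\<^sub>m 1\<^sub>m n *\<^sub>v v = k \<cdot>\<^sub>v v" using v by auto
    finally show ?thesis using v by auto
  qed
  have "A' = 0\<^sub>m n n"
  proof (rule ccontr)
    assume "A' \<noteq> 0\<^sub>m n n"
    then obtain B where B: "B \<in> carrier_mat n n" "B * A' = 1\<^sub>m n"
      using schur_intertwiner[OF G R R A' RA'] by blast
    have "v = (B * A') *\<^sub>v v" using B v by simp
    also have "\<dots> = B *\<^sub>v (A' *\<^sub>v v)" using B A' v by (intro assoc_mult_mat_vec) auto
    also have "\<dots> = 0\<^sub>v n" unfolding A'v using B by (intro eq_vecI) auto
    finally show False using v by simp
  qed
  then have Ak: "A = k \<cdot>\<^sub>m 1\<^sub>m n"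
  proof -
    assume z: "A' = 0\<^sub>m n n"
    show ?thesis
    proof (rule eq_matI)
      fix i j assume "i < dim_row (k \<cdot>\<^sub>m 1\<^sub>m n)" "j < dim_col (k \<cdot>\<^sub>m 1\<^sub>m n)"
      then have ij: "i < n" "j < n" by auto
      have "A' $$ (i, j) = 0" unfolding z using ij by simp
      then show "A $$ (i, j) = (k \<cdot>\<^sub>m 1\<^sub>m n) $$ (i, j)" using A ij by (simp add: A'_def)
    qed (use A in auto)
  qed
  have "mat_trace A = k * of_nat n" unfolding Ak by (simp add: mat_trace_smult[of _ n])
  then show ?thesis using Ak n by simp
qed

lemma sandwich_mult_vec:
  fixes X Y B C :: "complex mat"
  assumes X: "X \<in> carrier_mat n n" and B: "B \<in> carrier_mat n r" and C: "C \<in> carrier_mat r n"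
    and Y: "Y \<in> carrier_mat n n" and v: "v \<in> carrier_vec n"
  shows "X * (B * C) * Y *\<^sub>v v = X *\<^sub>v (B *\<^sub>v (C *\<^sub>v (Y *\<^sub>v v)))"
proof -
  have "X * (B * C) * Y *\<^sub>v v = X * (B * C) *\<^sub>v (Y *\<^sub>v v)"
    using assms by (intro assoc_mult_mat_vec) auto
  also have "\<dots> = X *\<^sub>v (B * C *\<^sub>v (Y *\<^sub>v v))"
    using assms by (intro assoc_mult_mat_vec) auto
  also have "B * C *\<^sub>v (Y *\<^sub>v v) = B *\<^sub>v (C *\<^sub>v (Y *\<^sub>v v))"
    using assms by (intro assoc_mult_mat_vec) auto
  finally show ?thesis .
qed

lemma sum_list_map_eq_sum_of_nat_count:
  fixes f :: "'a \<Rightarrow> 'b::comm_semiring_1"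
  assumes "finite X" "set xs \<subseteq> X"
  shows "sum_list (map f xs) = (\<Sum>x\<in>X. of_nat (count_list xs x) * f x)"
  using assms(2)
proof (induction xs)
  case (Cons a xs)
  have "(\<Sum>x\<in>X. of_nat (count_list (a # xs) x) * f x)
      = (\<Sum>x\<in>X. (if x = a then f a else 0) + of_nat (count_list xs x) * f x)"
    by (rule sum.cong) (auto simp: algebra_simps)
  then show ?case using Cons assms(1) by (simp add: sum.distrib)
qed simp

lemma mult_mat_assoc:
  fixes A B C :: "complex mat"
  shows "dim_col A = dim_row B \<Longrightarrow> dim_col B = dim_row C \<Longrightarrow> A * B * C = A * (B * C)"
  by (rule assoc_mult_mat) auto

section \<open>Averaging over a finite group, and orthogonality of characters\<close>

locale finite_group = group +
  assumes finite_carrier [simp]: "finite (carrier G)"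
begin

lemma carrier_nonempty [simp]: "carrier G \<noteq> {}"
  using one_closed by blast

lemma card_carrier_pos: "card (carrier G) > 0"
  by (metis card_gt_0_iff empty_iff finite_carrier one_closed)

lemma bij_betw_inv: "bij_betw (m_inv G) (carrier G) (carrier G)"
  by (rule bij_betwI[where g = "m_inv G"]) auto

lemma bij_betw_mult_left: "h \<in> carrier G \<Longrightarrow> bij_betw (\<lambda>g. h \<otimes> g) (carrier G) (carrier G)"
  by (simp add: bij_betw_def inj_on_cmult surj_const_mult)

lemma inv_mult_cancel_left [simp]:
  assumes "h \<in> carrier G" "y \<in> carrier G"
  shows "h \<otimes> (inv h \<otimes> y) = y" "inv h \<otimes> (h \<otimes> y) = y"
  using assms by (metis inv_closed l_one m_assoc r_inv, metis inv_closed l_one m_assoc l_inv)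

lemma bij_betw_conj: "h \<in> carrier G \<Longrightarrow> bij_betw (\<lambda>g. h \<otimes> g \<otimes> inv h) (carrier G) (carrier G)"
  by (rule bij_betwI[where g = "\<lambda>g. inv h \<otimes> g \<otimes> h"]) (auto simp: m_assoc)

lemma representationD:
  assumes "representation G n R"
  shows "g \<in> carrier G \<Longrightarrow> R g \<in> carrier_mat n n"
    and "g \<in> carrier G \<Longrightarrow> h \<in> carrier G \<Longrightarrow> R (g \<otimes> h) = R g * R h"
    and "R \<one> = 1\<^sub>m n"
    and "g \<in> carrier G \<Longrightarrow> R g * R (inv g) = 1\<^sub>m n"
    and "g \<in> carrier G \<Longrightarrow> R (inv g) * R g = 1\<^sub>m n"
  using assms by (auto simp: representation_iff[OF is_group] simp del: r_inv l_inv)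
    (metis inv_closed r_inv, metis inv_closed l_inv)

lemma irreducible_representationD:
  assumes "irreducible_representation G n R"
  shows "representation G n R" "n > 0"
  using assms by (auto simp: irreducible_representation_def)

text \<open>The standard way to make an intertwiner out of an arbitrary \<open>M\<close>, left
  without the factor 1/|G|. For \<open>M\<close> a matrix unit it yields orthogonality, for
  \<open>M\<close> a projection it yields Maschke's theorem.\<close>

definition average :: "nat \<Rightarrow> nat \<Rightarrow> ('a \<Rightarrow> complex mat) \<Rightarrow> complex mat \<Rightarrow> ('a \<Rightarrow> complex mat) \<Rightarrow> complex mat"
  where "average n m R M S = mat_sum n m (\<lambda>g. R g * M * S (inv g)) (carrier G)"

text \<open>Substituting \<open>h \<otimes> g\<close> for \<open>g\<close> permutes the summands;
  the factor \<open>S h\<close> is what remains after \<open>S (inv (h \<otimes> g))\<close> is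
  compared with \<open>S (inv g)\<close>.\<close>

lemma average_intertwines:
  assumes R: "representation G n R" and S: "representation G m S" and M: "M \<in> carrier_mat n m"
    and h: "h \<in> carrier G"
  shows "R h * average n m R M S = average n m R M S * S h"
proof -
  note Rd = representationD[OF R] and Sd = representationD[OF S]
  have car: "R g * M * S (inv g) \<in> carrier_mat n m" if "g \<in> carrier G" for g
    using Rd(1)[OF that] Sd(1)[OF inv_closed[OF that]] M by simp
  have "R h * average n m R M S = mat_sum n m (\<lambda>g. R h * (R g * M * S (inv g))) (carrier G)"
    unfolding average_def using Rd(1)[OF h] car by (rule mult_mat_sum)
  also have "\<dots> = mat_sum n m (\<lambda>g. R (h \<otimes> g) * M * S (inv (h \<otimes> g)) * S h) (carrier G)"
  proof (rule mat_sum_cong)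
    fix g assume g: "g \<in> carrier G"
    have "S (inv (h \<otimes> g)) * S h = S (inv (h \<otimes> g) \<otimes> h)"
      using g h by (subst Sd(2)) auto
    also have "inv (h \<otimes> g) \<otimes> h = inv g"
      using g h by (simp add: inv_mult_group m_assoc)
    finally have 1: "S (inv (h \<otimes> g)) * S h = S (inv g)" .
    have "R (h \<otimes> g) * M * S (inv (h \<otimes> g)) * S h = R (h \<otimes> g) * M * (S (inv (h \<otimes> g)) * S h)"
      using Rd(1)[of "h \<otimes> g"] M Sd(1)[of "inv (h \<otimes> g)"] Sd(1)[OF h] g h
      by (intro assoc_mult_mat[of _ n m _ m _ m]) auto
    also have "\<dots> = R h * R g * M * S (inv g)"
      unfolding 1 using g h by (simp add: Rd(2))
    also have "\<dots> = R h * (R g * M * S (inv g))"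
      using Rd(1)[OF g] Rd(1)[OF h] M Sd(1)[OF inv_closed[OF g]]
      by (simp add: assoc_mult_mat[of _ n n _ m _ m] assoc_mult_mat[of _ n n _ n _ m])
    finally show "R h * (R g * M * S (inv g)) = R (h \<otimes> g) * M * S (inv (h \<otimes> g)) * S h" by simp
  qed
  also have "\<dots> = mat_sum n m (\<lambda>g. R g * M * S (inv g) * S h) (carrier G)"
    by (rule mat_sum_reindex[OF bij_betw_mult_left[OF h], of n m "\<lambda>g. R g * M * S (inv g) * S h"])
  also have "\<dots> = average n m R M S * S h"
    unfolding average_def using Sd(1)[OF h] car by (rule mat_sum_mult[symmetric])
  finally show ?thesis .
qed

lemma average_carrier [simp]: "average n m R M S \<in> carrier_mat n m"
  by (simp add: average_def)

text \<open>
  The values at inverses replace the complex conjugates of the usual inner product; this gives the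
  same number on characters and avoids unitarity.
\<close>

definition char_inner :: "('a \<Rightarrow> complex) \<Rightarrow> ('a \<Rightarrow> complex) \<Rightarrow> complex"
  where "char_inner f \<chi> = (\<Sum>g\<in>carrier G. f g * \<chi> (inv g)) / of_nat (card (carrier G))"

text \<open>Expanding both traces gives products of diagonal coefficients, and each of these is an
  entry of a conjugated matrix unit. Orthogonality is thereby reduced to Schur's lemma for the
  averages.\<close>

lemma char_inner_sum_average:
  assumes R: "representation G n R" and S: "representation G m S"
  shows "of_nat (card (carrier G)) * char_inner (character G R) (character G S)
    = (\<Sum>i<n. \<Sum>j<m. average n m R (unit_mat n m i j) S $$ (i, j))"
proof -
  note Rd = representationD[OF R] and Sd = representationD[OF S]
  have "of_nat (card (carrier G)) * char_inner (character G R) (character G S)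
      = (\<Sum>g\<in>carrier G. mat_trace (R g) * mat_trace (S (inv g)))"
    using card_carrier_pos by (simp add: char_inner_def character_def)
  also have "\<dots> = (\<Sum>g\<in>carrier G. \<Sum>i<n. \<Sum>j<m. (R g * unit_mat n m i j * S (inv g)) $$ (i, j))"
  proof (rule sum.cong)
    fix g assume g: "g \<in> carrier G"
    have dim: "dim_row (R g) = n" "dim_row (S (inv g)) = m"
      using Rd(1)[OF g] Sd(1)[OF inv_closed[OF g]] by auto
    have "(R g * unit_mat n m i j * S (inv g)) $$ (i, j) = R g $$ (i, i) * S (inv g) $$ (j, j)"
      if "i < n" "j < m" for i j
      using that g by (intro mult_unit_mat_mult_index Rd(1) Sd(1)) auto
    then show "mat_trace (R g) * mat_trace (S (inv g))
        = (\<Sum>i<n. \<Sum>j<m. (R g * unit_mat n m i j * S (inv g)) $$ (i, j))"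
      by (simp add: mat_trace_def sum_product dim)
  qed simp
  also have "\<dots> = (\<Sum>i<n. \<Sum>j<m. \<Sum>g\<in>carrier G. (R g * unit_mat n m i j * S (inv g)) $$ (i, j))"
    by (subst sum.swap, rule sum.cong[OF refl], rule sum.swap)
  also have "\<dots> = (\<Sum>i<n. \<Sum>j<m. average n m R (unit_mat n m i j) S $$ (i, j))"
    by (simp add: average_def mat_sum_index)
  finally show ?thesis .
qed

text \<open>The average of the matrix unit at \<open>(i, j)\<close> is scalar, and cyclicity of the
  trace gives it the trace |G| or 0 according to whether \<open>i = j\<close>. So only the
  \<open>n\<close> diagonal positions contribute, |G|/n each.\<close>

lemma char_inner_self:
  assumes R: "irreducible_representation G n R"
  shows "char_inner (character G R) (character G R) = 1"
proof -
  note rep = irreducible_representationD[OF R]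
  note Rd = representationD[OF rep(1)]
  let ?N = "of_nat (card (carrier G)) :: complex"
  have "average n n R (unit_mat n n i j) R $$ (i, j) = (if i = j then ?N / of_nat n else 0)"
    if ij: "i < n" "j < n" for i j
  proof -
    let ?A = "average n n R (unit_mat n n i j) R"
    have "mat_trace ?A = (\<Sum>g\<in>carrier G. mat_trace (R g * unit_mat n n i j * R (inv g)))"
      unfolding average_def by (rule mat_trace_mat_sum)
        (metis Rd(1) inv_closed mult_carrier_mat unit_mat_carrier)
    also have "\<dots> = (\<Sum>g\<in>carrier G. mat_trace (unit_mat n n i j))"
    proof (rule sum.cong)
      fix g assume g: "g \<in> carrier G"
      have c: "R g \<in> carrier_mat n n" "R (inv g) \<in> carrier_mat n n" using Rd(1) g by auto
      have "mat_trace (R g * unit_mat n n i j * R (inv g))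
          = mat_trace (R (inv g) * (R g * unit_mat n n i j))"
        using c by (intro mat_trace_comm) auto
      also have "R (inv g) * (R g * unit_mat n n i j) = R (inv g) * R g * unit_mat n n i j"
        using c by (intro assoc_mult_mat[symmetric, of _ n n _ n _ n]) auto
      finally show "mat_trace (R g * unit_mat n n i j * R (inv g)) = mat_trace (unit_mat n n i j)"
        using Rd(5)[OF g] left_mult_one_mat[OF unit_mat_carrier] by simp
    qed simp
    also have "mat_trace (unit_mat n n i j) = (if i = j then 1 else 0)"
      using ij by (auto simp: mat_trace_def unit_mat_def)
    finally have tr: "mat_trace ?A = (if i = j then ?N else 0)" by simp
    have "?A = (mat_trace ?A / of_nat n) \<cdot>\<^sub>m 1\<^sub>m n"
      using rep(1) by (intro schur_scalar[OF is_group R]) (auto intro!: average_intertwines)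
    then have "?A $$ (i, j) = ((mat_trace ?A / of_nat n) \<cdot>\<^sub>m 1\<^sub>m n) $$ (i, j)" by simp
    then show ?thesis using ij tr by simp
  qed
  then have "?N * char_inner (character G R) (character G R) = (\<Sum>i<n. \<Sum>j<n. if i = j then ?N / of_nat n else 0)"
    by (simp add: char_inner_sum_average[OF rep(1) rep(1)])
  also have "\<dots> = ?N" using rep(2) by simp
  finally show ?thesis using card_carrier_pos by simp
qed

text \<open>A nonzero average would be an invertible intertwiner, hence \<open>R\<close> and
  \<open>S\<close> would be similar and have the same traces. So all the averages vanish.\<close>

lemma char_inner_distinct:
  assumes R: "irreducible_representation G n R" and S: "irreducible_representation G m S"
    and neq: "character G R \<noteq> character G S"
  shows "char_inner (character G R) (character G S) = 0"
proof -
  note repR = irreducible_representationD[OF R] and repS = irreducible_representationD[OF S]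
  note Rd = representationD[OF repR(1)] and Sd = representationD[OF repS(1)]
  have "average n m R M S = 0\<^sub>m n m" if M: "M \<in> carrier_mat n m" for M
  proof (rule ccontr)
    let ?A = "average n m R M S"
    assume "?A \<noteq> 0\<^sub>m n m"
    then obtain B where B: "B \<in> carrier_mat m n" "?A * B = 1\<^sub>m n" "B * ?A = 1\<^sub>m m"
      using schur_intertwiner[OF is_group R S average_carrier average_intertwines[OF repR(1) repS(1) M]] by blast
    have "mat_trace (R g) = mat_trace (S g)" if g: "g \<in> carrier G" for g
    proof -
      have c: "R g \<in> carrier_mat n n" "S g \<in> carrier_mat m m" "?A \<in> carrier_mat n m"
        using Rd(1)[OF g] Sd(1)[OF g] by auto
      have "S g = B * ?A * S g" using B c by simp
      also have "\<dots> = B * (?A * S g)" using B c by (intro assoc_mult_mat) auto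
      also have "\<dots> = B * (R g * ?A)" using average_intertwines[OF repR(1) repS(1) M g] by simp
      finally have "mat_trace (S g) = mat_trace (B * (R g * ?A))" by simp
      also have "\<dots> = mat_trace (R g * ?A * B)"
        using B c by (intro mat_trace_comm) auto
      also have "R g * ?A * B = R g * (?A * B)" using B c by (intro assoc_mult_mat) auto
      finally show ?thesis using B c by simp
    qed
    then have "character G R = character G S" by (auto simp: character_def)
    then show False using neq by simp
  qed
  then have "of_nat (card (carrier G)) * char_inner (character G R) (character G S) = 0"
    by (simp add: char_inner_sum_average[OF repR(1) repS(1)])
  then show ?thesis using card_carrier_pos by simp
qed

lemma char_inner_Irr:
  assumes "\<chi> \<in> Irr G" "\<psi> \<in> Irr G"
  shows "char_inner \<chi> \<psi> = (if \<chi> = \<psi> then 1 else 0)"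
  using assms char_inner_self char_inner_distinct unfolding Irr_def by force

lemma char_inner_commute: "char_inner f \<chi> = char_inner \<chi> f"
proof -
  have "(\<Sum>g\<in>carrier G. f g * \<chi> (inv g)) = (\<Sum>g\<in>carrier G. f (inv g) * \<chi> (inv (inv g)))"
    by (rule sum.reindex_bij_betw[OF bij_betw_inv, symmetric])
  then show ?thesis by (simp add: char_inner_def mult.commute)
qed

lemma Irr_one:
  assumes "\<chi> \<in> Irr G"
  obtains d :: nat where "d > 0" "\<chi> \<one> = of_nat d"
proof -
  from assms obtain n R where "irreducible_representation G n R" "\<chi> = character G R"
    by (auto simp: Irr_def)
  then show ?thesis
    using that[of n] irreducible_representationD[of n R] representationD(3)[of n R]
    by (simp add: character_def)
qed

section \<open>Maschke's theorem and complete reducibility\<close>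

text \<open>\<open>B * C\<close> projects onto \<open>W\<close> but need not commute with the
  action; its normalised average \<open>P\<close> does. Each conjugate of \<open>B * C\<close> fixes
  \<open>W\<close> pointwise and maps into \<open>W\<close>, so \<open>P * B = B\<close> and
  \<open>B * C * P = P\<close>, and these two equations give idempotence. \<open>P\<close> is
  neither zero nor the identity because \<open>W\<close> is proper and nonzero.\<close>

lemma commuting_projection:
  assumes R: "representation G n R" and W: "invariant_subspace G n R W"
    and nt: "W \<noteq> {0\<^sub>v n}" "W \<noteq> carrier_vec n"
  obtains P where "P \<in> carrier_mat n n" "P * P = P" "P \<noteq> 0\<^sub>m n n" "P \<noteq> 1\<^sub>m n"
    "\<And>g. g \<in> carrier G \<Longrightarrow> R g * P = P * R g"
proof -
  note Rd = representationD[OF R]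
  let ?N = "of_nat (card (carrier G)) :: complex"
  have N: "?N \<noteq> 0" using card_carrier_pos by simp
  have sub: "VectorSpace.subspace (class_ring :: complex ring) W (module_vec TYPE(complex) n)"
    and inv: "\<And>g w. g \<in> carrier G \<Longrightarrow> w \<in> W \<Longrightarrow> R g *\<^sub>v w \<in> W"
    using W by (auto simp: invariant_subspace_def)
  have Wn: "W \<subseteq> carrier_vec n" "0\<^sub>v n \<in> W" using sub by (auto simp: subspace_vec_iff)
  from subspace_vec_basis_matrix[OF sub] obtain r B C
    where B: "B \<in> carrier_mat n r" and C: "C \<in> carrier_mat r n" and CB: "C * B = 1\<^sub>m r"
      and BW: "\<And>v. v \<in> carrier_vec r \<Longrightarrow> B *\<^sub>v v \<in> W"
      and BC: "\<And>w. w \<in> W \<Longrightarrow> B *\<^sub>v (C *\<^sub>v w) = w" by metis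
  define A where "A = average n n R (B * C) R"
  define P where "P = (1 / ?N) \<cdot>\<^sub>m A"
  have A: "A \<in> carrier_mat n n" by (simp add: A_def)
  have P: "P \<in> carrier_mat n n" by (simp add: P_def A)
  have BCc: "B * C \<in> carrier_mat n n" using B C by simp
  have RA: "R g * A = A * R g" if "g \<in> carrier G" for g
    unfolding A_def using average_intertwines[OF R R BCc that] .
  \<comment> \<open>\<open>R (inv g)\<close> sends the range of \<open>B\<close> into
    \<open>W\<close>, where \<open>B * C\<close> acts as the identity, so \<open>R g\<close> and
    \<open>R (inv g)\<close> cancel.\<close>
  have RBRB: "R g * (B * C) * R (inv g) * B = B" if g: "g \<in> carrier G" for g
  proof (rule mat_eq_if_mult_vec_eq)
    fix v :: "complex vec" assume v: "v \<in> carrier_vec r"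
    have c: "R g \<in> carrier_mat n n" "R (inv g) \<in> carrier_mat n n" using Rd(1) g by auto
    have w: "R (inv g) *\<^sub>v (B *\<^sub>v v) \<in> W" using inv g BW v by simp
    have "R g * (B * C) * R (inv g) * B *\<^sub>v v = R g * (B * C) * R (inv g) *\<^sub>v (B *\<^sub>v v)"
      using c B C v by (intro assoc_mult_mat_vec) auto
    also have "\<dots> = R g *\<^sub>v (B *\<^sub>v (C *\<^sub>v (R (inv g) *\<^sub>v (B *\<^sub>v v))))"
      using c B C v by (intro sandwich_mult_vec) auto
    also have "\<dots> = R g *\<^sub>v (R (inv g) *\<^sub>v (B *\<^sub>v v))" using BC[OF w] by simp
    also have "\<dots> = (R g * R (inv g)) *\<^sub>v (B *\<^sub>v v)"
      using c B v by (intro assoc_mult_mat_vec[symmetric]) auto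
    finally show "R g * (B * C) * R (inv g) * B *\<^sub>v v = B *\<^sub>v v"
      using Rd(4)[OF g] B v by simp
  qed (use Rd(1)[OF g] Rd(1)[OF inv_closed[OF g]] B C in auto)
  have car: "R g * (B * C) * R (inv g) \<in> carrier_mat n n" if "g \<in> carrier G" for g
    using Rd(1)[OF that] Rd(1)[OF inv_closed[OF that]] BCc by simp
  have "A * B = mat_sum n r (\<lambda>g. R g * (B * C) * R (inv g) * B) (carrier G)"
    unfolding A_def average_def using B car by (rule mat_sum_mult)
  also have "\<dots> = mat_sum n r (\<lambda>g. B) (carrier G)"
    by (rule mat_sum_cong) (rule RBRB)
  also have "\<dots> = ?N \<cdot>\<^sub>m B"
    using B by (intro eq_matI) (auto simp: mat_sum_def)
  finally have AB: "A * B = ?N \<cdot>\<^sub>m B" .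
  have "P * B = (1 / ?N) \<cdot>\<^sub>m (A * B)"
    unfolding P_def by (rule mult_smult_assoc_mat[OF A B])
  also have "\<dots> = B" unfolding AB using N B by (intro eq_matI) auto
  finally have PB: "P * B = B" .
  have "B * C * A = mat_sum n n (\<lambda>g. B * C * (R g * (B * C) * R (inv g))) (carrier G)"
    unfolding A_def average_def using BCc car by (rule mult_mat_sum)
  also have "\<dots> = mat_sum n n (\<lambda>g. R g * (B * C) * R (inv g)) (carrier G)"
  proof (rule mat_sum_cong)
    fix g assume g: "g \<in> carrier G"
    have c: "R g \<in> carrier_mat n n" "R (inv g) \<in> carrier_mat n n" using Rd(1) g by auto
    show "B * C * (R g * (B * C) * R (inv g)) = R g * (B * C) * R (inv g)"
    proof (rule mat_eq_if_mult_vec_eq)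
      fix v :: "complex vec" assume v: "v \<in> carrier_vec n"
      have w: "R g *\<^sub>v (B *\<^sub>v (C *\<^sub>v (R (inv g) *\<^sub>v v))) \<in> W"
        using c C v by (intro inv g BW) auto
      have 1: "R g * (B * C) * R (inv g) *\<^sub>v v = R g *\<^sub>v (B *\<^sub>v (C *\<^sub>v (R (inv g) *\<^sub>v v)))"
        using c B C v by (intro sandwich_mult_vec) auto
      have "B * C * (R g * (B * C) * R (inv g)) *\<^sub>v v = (B * C) *\<^sub>v (R g * (B * C) * R (inv g) *\<^sub>v v)"
        using v BCc car[OF g] by (intro assoc_mult_mat_vec) auto
      also have "\<dots> = B *\<^sub>v (C *\<^sub>v (R g *\<^sub>v (B *\<^sub>v (C *\<^sub>v (R (inv g) *\<^sub>v v)))))"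
        unfolding 1 using B C Wn w by (intro assoc_mult_mat_vec) auto
      also have "\<dots> = R g * (B * C) * R (inv g) *\<^sub>v v"
        unfolding BC[OF w] 1 ..
      finally show "B * C * (R g * (B * C) * R (inv g)) *\<^sub>v v = R g * (B * C) * R (inv g) *\<^sub>v v" .
    qed (use BCc car[OF g] in auto)
  qed
  also have "\<dots> = A" by (simp add: A_def average_def)
  finally have BCA: "B * C * A = A" .
  have BCP: "B * C * P = P"
    unfolding P_def using mult_smult_distrib[OF BCc A, of "1 / ?N"] BCA by simp
  have PBC: "P * (B * C) = B * C"
    using P B C PB by (metis assoc_mult_mat)
  have "P * P = P * (B * C * P)" unfolding BCP ..
  also have "\<dots> = P * (B * C) * P" using P BCc by (metis assoc_mult_mat)
  also have "\<dots> = P" unfolding PBC BCP ..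
  finally have PP: "P * P = P" .
  have Pw: "P *\<^sub>v w = w" if w: "w \<in> W" for w
  proof -
    have wn: "w \<in> carrier_vec n" using Wn w by auto
    have "P *\<^sub>v w = P *\<^sub>v (B *\<^sub>v (C *\<^sub>v w))" using BC[OF w] by simp
    also have "\<dots> = (P * B) *\<^sub>v (C *\<^sub>v w)"
      using P B C wn by (intro assoc_mult_mat_vec[symmetric]) auto
    finally show ?thesis using PB BC[OF w] by simp
  qed
  have P0: "P \<noteq> 0\<^sub>m n n"
  proof
    assume P0: "P = 0\<^sub>m n n"
    have "w = 0\<^sub>v n" if w: "w \<in> W" for w
    proof -
      have "w \<in> carrier_vec n" using Wn w by auto
      then have "0\<^sub>m n n *\<^sub>v w = 0\<^sub>v n" by (intro eq_vecI) auto
      then show ?thesis using Pw[OF w] by (simp add: P0)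
    qed
    then show False using nt(1) Wn(2) by blast
  qed
  have P1: "P \<noteq> 1\<^sub>m n"
  proof
    assume P1: "P = 1\<^sub>m n"
    have BC1: "B * C = 1\<^sub>m n" using BCP right_mult_one_mat[OF BCc] by (simp only: P1)
    have "v \<in> W" if v: "v \<in> carrier_vec n" for v
    proof -
      have "v = (B * C) *\<^sub>v v" unfolding BC1 using v by simp
      also have "\<dots> = B *\<^sub>v (C *\<^sub>v v)" using v B C by (intro assoc_mult_mat_vec) auto
      finally show ?thesis using BW[of "C *\<^sub>v v"] C v by simp
    qed
    then show False using nt(2) Wn(1) by auto
  qed
  have "R g * P = P * R g" if g: "g \<in> carrier G" for g
    unfolding P_def mult_smult_distrib[OF Rd(1)[OF g] A] mult_smult_assoc_mat[OF A Rd(1)[OF g]] RA[OF g] ..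
  with that P PP P0 P1 show ?thesis by blast
qed

text \<open>
  Compressing \<open>R\<close> to \<open>C R B\<close> turns the range of a commuting projection \<open>P = B C\<close> into a representation
  in matrix form, without a change of basis.
\<close>

lemma commuting_idempotent_factorization:
  assumes R: "representation G n R" and P: "P \<in> carrier_mat n n" and PP: "P * P = P"
    and RP: "\<And>g. g \<in> carrier G \<Longrightarrow> R g * P = P * R g"
  obtains r B C where "B \<in> carrier_mat n r" "C \<in> carrier_mat r n" "P = B * C" "C * B = 1\<^sub>m r"
proof -
  note Rd = representationD[OF R]
  have "invariant_subspace G n R ((*\<^sub>v) P ` carrier_vec n)"
    using invariant_subspace_mult_vec_range[where G = G and R = R and S = R, OF P Rd(1) Rd(1) RP] .
  then have "VectorSpace.subspace (class_ring :: complex ring) ((*\<^sub>v) P ` carrier_vec n) (module_vec TYPE(complex) n)"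
    by (simp add: invariant_subspace_def)
  from subspace_vec_basis_matrix[OF this] obtain r B C
    where B: "B \<in> carrier_mat n r" and C: "C \<in> carrier_mat r n" and CB: "C * B = 1\<^sub>m r"
      and BW: "\<And>v. v \<in> carrier_vec r \<Longrightarrow> B *\<^sub>v v \<in> (*\<^sub>v) P ` carrier_vec n"
      and BC: "\<And>w. w \<in> (*\<^sub>v) P ` carrier_vec n \<Longrightarrow> B *\<^sub>v (C *\<^sub>v w) = w" by metis
  have PB: "P * B = B"
  proof (rule mat_eq_if_mult_vec_eq)
    fix v :: "complex vec" assume v: "v \<in> carrier_vec r"
    from BW[OF v] obtain u where u: "u \<in> carrier_vec n" "B *\<^sub>v v = P *\<^sub>v u" by auto
    have "P * B *\<^sub>v v = P *\<^sub>v (B *\<^sub>v v)" using P B v by (intro assoc_mult_mat_vec) auto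
    also have "\<dots> = (P * P) *\<^sub>v u" unfolding u using P u by (intro assoc_mult_mat_vec[symmetric]) auto
    finally show "P * B *\<^sub>v v = B *\<^sub>v v" using PP u by simp
  qed (use P B in auto)
  \<comment> \<open>\<open>B * C\<close> is only some projection onto the range of \<open>P\<close>.
    Replacing \<open>C\<close> by \<open>C * P\<close> also forces its kernel to be that of
    \<open>P\<close>, so that the product becomes \<open>P\<close> itself.\<close>
  have BCP: "B * (C * P) = P"
  proof (rule mat_eq_if_mult_vec_eq)
    fix v :: "complex vec" assume v: "v \<in> carrier_vec n"
    have "B * (C * P) *\<^sub>v v = B *\<^sub>v (C * P *\<^sub>v v)" using P B C v by (intro assoc_mult_mat_vec) auto
    also have "C * P *\<^sub>v v = C *\<^sub>v (P *\<^sub>v v)" using P C v by (intro assoc_mult_mat_vec) auto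
    finally show "B * (C * P) *\<^sub>v v = P *\<^sub>v v" using BC v by simp
  qed (use P B C in auto)
  have "C * P * B = C * (P * B)" using P B C by (intro assoc_mult_mat) auto
  then have "C * P * B = 1\<^sub>m r" using PB CB by simp
  with that[of B r "C * P"] B C P BCP show ?thesis by simp
qed

lemma compressed_representation:
  assumes R: "representation G n R" and B: "B \<in> carrier_mat n r" and C: "C \<in> carrier_mat r n"
    and CB: "C * B = 1\<^sub>m r" and RP: "\<And>g. g \<in> carrier G \<Longrightarrow> R g * (B * C) = (B * C) * R g"
  shows "representation G r (\<lambda>g. C * R g * B)"
    and "g \<in> carrier G \<Longrightarrow> mat_trace (C * R g * B) = mat_trace (R g * (B * C))"
proof -
  note Rd = representationD[OF R]
  show "representation G r (\<lambda>g. C * R g * B)"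
    unfolding representation_iff[OF is_group]
  proof (intro conjI ballI)
    fix g h assume g: "g \<in> carrier G" and h: "h \<in> carrier G"
    have c: "R g \<in> carrier_mat n n" "R h \<in> carrier_mat n n" using Rd(1) g h by auto
    note dims = carrier_matD[OF c(1)] carrier_matD[OF c(2)] carrier_matD[OF B] carrier_matD[OF C]
    \<comment> \<open>These two rules carry a trailing factor \<open>M\<close> so that they apply
      inside products bracketed to the right: one moves \<open>B * C\<close> past
      \<open>R g\<close>, the other cancels \<open>C * B\<close>.\<close>
    have CB': "C * (B * M) = M" if "dim_row M = r" for M
      using CB that dims by (simp flip: mult_mat_assoc)
    have RP': "R g * (B * (C * M)) = B * (C * (R g * M))" if "dim_row M = n" for M
      using arg_cong[OF RP[OF g], of "\<lambda>X. X * M"] that dims by (simp add: mult_mat_assoc)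
    show "C * R (g \<otimes> h) * B = C * R g * B * (C * R h * B)"
      using dims by (simp add: mult_mat_assoc Rd(2)[OF g h] RP' CB')
  next
    show "C * R \<one> * B = 1\<^sub>m r" using C CB by (simp add: Rd(3))
  qed (use Rd(1) B C in auto)
  assume g: "g \<in> carrier G"
  have c: "R g \<in> carrier_mat n n" using Rd(1)[OF g] .
  have "C * R g * B = C * (R g * B)" using c B C by (intro assoc_mult_mat) auto
  then have "mat_trace (C * R g * B) = mat_trace (R g * B * C)"
    using mat_trace_comm[of C r n "R g * B"] c B C by simp
  also have "R g * B * C = R g * (B * C)" using c B C by (intro assoc_mult_mat) auto
  finally show "mat_trace (C * R g * B) = mat_trace (R g * (B * C))" .
qed

text \<open>Recording the dimension as the trace of \<open>P\<close> makes the dimensions for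
  \<open>P\<close> and its complement add up to \<open>n\<close> with no further argument about
  subspaces.\<close>

lemma commuting_projection_subrepresentation:
  assumes R: "representation G n R" and P: "P \<in> carrier_mat n n" and PP: "P * P = P"
    and RP: "\<And>g. g \<in> carrier G \<Longrightarrow> R g * P = P * R g" and P0: "P \<noteq> 0\<^sub>m n n"
  obtains r S where "r > 0" "representation G r S" "mat_trace P = of_nat r"
    "\<And>g. g \<in> carrier G \<Longrightarrow> mat_trace (S g) = mat_trace (R g * P)"
proof -
  obtain r B C where B: "B \<in> carrier_mat n r" and C: "C \<in> carrier_mat r n" and PBC: "P = B * C"
    and CB: "C * B = 1\<^sub>m r"
    by (rule commuting_idempotent_factorization[OF R P PP RP])
  have RBC: "\<And>g. g \<in> carrier G \<Longrightarrow> R g * (B * C) = (B * C) * R g"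
    using RP PBC by simp
  have "r > 0"
  proof (rule ccontr)
    assume "\<not> r > 0"
    then have "P = 0\<^sub>m n n" using B C unfolding PBC by (intro eq_matI) (auto simp: scalar_prod_def)
    then show False using P0 by simp
  qed
  moreover have "mat_trace P = of_nat r"
    unfolding PBC using mat_trace_comm[OF B C] CB by simp
  ultimately show ?thesis
    using that compressed_representation[where R = R, OF R B C CB RBC] PBC by blast
qed

text \<open>Complete reducibility at the level of characters, by splitting along a projection and
  its complement. The constituents form a list, which records repetitions and presupposes nothing
  about the finiteness of \<open>Irr G\<close>; that is derived from this lemma later.\<close>

lemma character_sum_list_Irr:
  assumes "representation G n R"
  shows "\<exists>xs. set xs \<subseteq> Irr G \<and> (\<forall>g\<in>carrier G. mat_trace (R g) = sum_list (map (\<lambda>\<chi>. \<chi> g) xs))"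
  using assms
proof (induction n arbitrary: R rule: less_induct)
  case (less n)
  note R = less.prems
  note Rd = representationD[OF R]
  consider "n = 0" | "irreducible_representation G n R"
    | W where "invariant_subspace G n R W" "W \<noteq> {0\<^sub>v n}" "W \<noteq> carrier_vec n"
    using R by (auto simp: irreducible_representation_def)
  then show ?case
  proof cases
    \<comment> \<open>Irreducibility demands positive dimension, so the zero-dimensional
      representation corresponds to the empty list.\<close>
    case 1
    then have "mat_trace (R g) = 0" if "g \<in> carrier G" for g
      using carrier_matD(1)[OF Rd(1)[OF that]] by (simp add: mat_trace_def)
    then show ?thesis by (intro exI[of _ "[]"]) simp
  next
    case 2
    then show ?thesis
      by (intro exI[of _ "[character G R]"]) (auto simp: Irr_def character_def)
  next
    case 3
    then obtain P where P: "P \<in> carrier_mat n n" "P * P = P" "P \<noteq> 0\<^sub>m n n" "P \<noteq> 1\<^sub>m n"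
      and RP: "\<And>g. g \<in> carrier G \<Longrightarrow> R g * P = P * R g"
      using commuting_projection[OF R] by blast
    define Q where "Q = 1\<^sub>m n - P"
    have Q: "Q \<in> carrier_mat n n" unfolding Q_def using P(1) by (rule minus_carrier_mat)
    have PQ: "P + Q = 1\<^sub>m n" using P(1) by (intro eq_matI) (auto simp: Q_def)
    have RQ: "R g * Q = Q * R g" if g: "g \<in> carrier G" for g
    proof -
      have "R g * Q = R g * 1\<^sub>m n - R g * P"
        unfolding Q_def using Rd(1)[OF g] P by (intro mult_minus_distrib_mat) auto
      moreover have "Q * R g = 1\<^sub>m n * R g - P * R g"
        unfolding Q_def using Rd(1)[OF g] P by (intro minus_mult_distrib_mat) auto
      ultimately show ?thesis using RP[OF g] Rd(1)[OF g] by simp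
    qed
    have "Q * Q = 1\<^sub>m n * Q - P * Q"
      unfolding Q_def using P by (intro minus_mult_distrib_mat) auto
    also have "P * Q = P * 1\<^sub>m n - P * P"
      unfolding Q_def using P by (intro mult_minus_distrib_mat) auto
    also have "\<dots> = 0\<^sub>m n n" using P by simp
    also have "1\<^sub>m n * Q - 0\<^sub>m n n = Q" using Q by (intro eq_matI) auto
    finally have QQ: "Q * Q = Q" .
    have Q0: "Q \<noteq> 0\<^sub>m n n"
    proof
      assume "Q = 0\<^sub>m n n"
      then have "P = 1\<^sub>m n" using PQ P(1) by simp
      then show False using P(4) by simp
    qed
    obtain r S where S: "r > 0" "representation G r S" "mat_trace P = of_nat r"
      "\<And>g. g \<in> carrier G \<Longrightarrow> mat_trace (S g) = mat_trace (R g * P)"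
      using commuting_projection_subrepresentation[OF R P(1,2) RP P(3)] by blast
    obtain s T where T: "s > 0" "representation G s T" "mat_trace Q = of_nat s"
      "\<And>g. g \<in> carrier G \<Longrightarrow> mat_trace (T g) = mat_trace (R g * Q)"
      using commuting_projection_subrepresentation[OF R Q QQ RQ Q0] by blast
    have "of_nat (r + s) = mat_trace (P + Q)"
      using mat_trace_add[OF P(1) Q] S T by simp
    then have "(of_nat (r + s) :: complex) = of_nat n" unfolding PQ by simp
    then have "r + s = n" by (simp only: of_nat_eq_iff)
    then have "r < n" "s < n" using S T by auto
    then obtain xs ys where xs: "set xs \<subseteq> Irr G" "set ys \<subseteq> Irr G"
      "\<And>g. g \<in> carrier G \<Longrightarrow> mat_trace (S g) = sum_list (map (\<lambda>\<chi>. \<chi> g) xs)"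
      "\<And>g. g \<in> carrier G \<Longrightarrow> mat_trace (T g) = sum_list (map (\<lambda>\<chi>. \<chi> g) ys)"
      using less.IH S(2) T(2) by metis
    have "mat_trace (R g) = sum_list (map (\<lambda>\<chi>. \<chi> g) (xs @ ys))" if g: "g \<in> carrier G" for g
    proof -
      have "R g = R g * (P + Q)" unfolding PQ using Rd(1)[OF g] by simp
      also have "\<dots> = R g * P + R g * Q" using Rd(1)[OF g] P(1) Q by (intro mult_add_distrib_mat) auto
      finally have "mat_trace (R g) = mat_trace (R g * P + R g * Q)" by simp
      also have "\<dots> = mat_trace (R g * P) + mat_trace (R g * Q)"
        using Rd(1)[OF g] P(1) Q by (intro mat_trace_add[of _ n]) auto
      finally show ?thesis using xs g S(4) T(4) by simp
    qed
    then show ?thesis using xs by (intro exI[of _ "xs @ ys"]) auto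
  qed
qed

section \<open>Completeness of the irreducible characters\<close>

text \<open>Permutation matrices of left multiplication, with respect to an enumeration
  \<open>e\<close> of the group. The trace counts fixed points, and only the identity has
  any.\<close>

lemma regular_representation:
  obtains R where "representation G (card (carrier G)) R"
    "\<And>g. g \<in> carrier G \<Longrightarrow> mat_trace (R g) = (if g = \<one> then of_nat (card (carrier G)) else 0)"
proof -
  let ?N = "card (carrier G)"
  obtain e where e: "bij_betw e {0..<?N} (carrier G)"
    using ex_bij_betw_nat_finite[OF finite_carrier] by blast
  have ec: "e i \<in> carrier G" if "i < ?N" for i using e that by (auto simp: bij_betw_def)
  have ei: "e i = e j \<longleftrightarrow> i = j" if "i < ?N" "j < ?N" for i j
    using e that by (auto simp: bij_betw_def inj_on_def)
  define R where "R = (\<lambda>g. mat ?N ?N (\<lambda>(i, j). if e i = g \<otimes> e j then 1 else (0::complex)))"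
  have "representation G ?N R"
    unfolding representation_iff[OF is_group]
  proof (intro conjI ballI)
    show "R g \<in> carrier_mat ?N ?N" for g by (simp add: R_def)
    show "R \<one> = 1\<^sub>m ?N" by (intro eq_matI) (auto simp: R_def ec ei)
    fix g h assume g: "g \<in> carrier G" and h: "h \<in> carrier G"
    show "R (g \<otimes> h) = R g * R h"
    proof (rule eq_matI)
      fix i j assume "i < dim_row (R g * R h)" "j < dim_col (R g * R h)"
      then have ij: "i < ?N" "j < ?N" by (auto simp: R_def)
      have "h \<otimes> e j \<in> e ` {0..<?N}" using h ec ij by (simp add: bij_betw_imp_surj_on[OF e])
      \<comment> \<open>Column \<open>j\<close> of \<open>R h\<close> has its single entry 1 in row
        \<open>k\<close>, so the matrix product has at most one nonzero summand.\<close>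
      then obtain k where k: "k < ?N" "e k = h \<otimes> e j" by force
      have "(R g * R h) $$ (i, j)
          = (\<Sum>l<?N. (if e i = g \<otimes> e l then 1 else 0) * (if e l = h \<otimes> e j then 1 else 0))"
        using ij by (auto simp: R_def scalar_prod_def lessThan_atLeast0)
      also have "\<dots> = (\<Sum>l<?N. if l = k then (if e i = g \<otimes> (h \<otimes> e j) then 1 else 0) else 0)"
        using k ei by (intro sum.cong) (auto simp flip: k(2))
      also have "\<dots> = R (g \<otimes> h) $$ (i, j)"
        using k g h ij ec by (simp add: R_def m_assoc)
      finally show "R (g \<otimes> h) $$ (i, j) = (R g * R h) $$ (i, j)" by simp
    qed (auto simp: R_def)
  qed
  moreover have "mat_trace (R g) = (if g = \<one> then of_nat ?N else 0)" if g: "g \<in> carrier G" for g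
  proof -
    have "e i = g \<otimes> e i \<longleftrightarrow> g = \<one>" if "i < ?N" for i
      using ec[OF that] g by (metis l_one one_closed right_cancel)
    then have "mat_trace (R g) = (\<Sum>i<?N. if g = \<one> then 1 else 0)"
      by (auto simp: mat_trace_def R_def intro!: sum.cong)
    then show ?thesis by simp
  qed
  ultimately show ?thesis using that by blast
qed

text \<open>Orthogonality extracts coefficients. \<open>X\<close> is a finite subset because the
  first application precedes the finiteness of \<open>Irr G\<close>; later ones take all of
  \<open>Irr G\<close> and obtain uniqueness of multiplicities.\<close>

lemma char_inner_sum_Irr:
  assumes X: "finite X" "X \<subseteq> Irr G" and \<chi>: "\<chi> \<in> Irr G"
    and f: "\<And>g. g \<in> carrier G \<Longrightarrow> f g = (\<Sum>\<psi>\<in>X. a \<psi> * \<psi> g)"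
  shows "char_inner f \<chi> = (if \<chi> \<in> X then a \<chi> else 0)"
proof -
  have "char_inner f \<chi> = (\<Sum>g\<in>carrier G. \<Sum>\<psi>\<in>X. a \<psi> * (\<psi> g * \<chi> (inv g))) / of_nat (card (carrier G))"
    by (simp add: char_inner_def f sum_distrib_right mult.assoc)
  also have "\<dots> = (\<Sum>\<psi>\<in>X. a \<psi> * char_inner \<psi> \<chi>)"
    by (subst sum.swap) (simp add: char_inner_def sum_distrib_left sum_divide_distrib)
  also have "\<dots> = (\<Sum>\<psi>\<in>X. if \<psi> = \<chi> then a \<chi> else 0)"
    using X \<chi> by (intro sum.cong) (auto simp: char_inner_Irr)
  finally show ?thesis using X by simp
qed

text \<open>The regular character is concentrated at the identity, so its inner product with \<chi>
  is the degree of \<chi>. This is positive, hence every irreducible character occurs in the finite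
  list of constituents, with multiplicity equal to its degree.\<close>

lemma finite_Irr [simp]: "finite (Irr G)"
  and sum_Irr_degree: "g \<in> carrier G \<Longrightarrow>
    (\<Sum>\<chi>\<in>Irr G. \<chi> \<one> * \<chi> g) = (if g = \<one> then of_nat (card (carrier G)) else 0)"
proof -
  let ?f = "\<lambda>g. if g = \<one> then of_nat (card (carrier G)) else 0 :: complex"
  obtain R where R: "representation G (card (carrier G)) R" "\<And>g. g \<in> carrier G \<Longrightarrow> mat_trace (R g) = ?f g"
    using regular_representation by blast
  obtain xs where xs: "set xs \<subseteq> Irr G" "\<And>g. g \<in> carrier G \<Longrightarrow> mat_trace (R g) = sum_list (map (\<lambda>\<chi>. \<chi> g) xs)"
    using character_sum_list_Irr[OF R(1)] by blast
  define a :: "('a \<Rightarrow> complex) \<Rightarrow> complex" where "a = (\<lambda>\<psi>. of_nat (count_list xs \<psi>))"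
  have f: "?f g = (\<Sum>\<psi>\<in>set xs. a \<psi> * \<psi> g)" if "g \<in> carrier G" for g
    using R(2)[OF that] xs(2)[OF that] sum_list_map_eq_sum_of_nat_count[of "set xs" xs "\<lambda>\<psi>. \<psi> g"]
    by (simp add: a_def)
  have inner: "char_inner ?f \<chi> = \<chi> \<one>" for \<chi>
  proof -
    have "(\<Sum>g\<in>carrier G. ?f g * \<chi> (inv g)) = (\<Sum>g\<in>{\<one>}. ?f g * \<chi> (inv g))"
      by (rule sum.mono_neutral_right) auto
    then show ?thesis using card_carrier_pos by (simp add: char_inner_def)
  qed
  have eq: "\<chi> \<one> = (if \<chi> \<in> set xs then a \<chi> else 0)" if "\<chi> \<in> Irr G" for \<chi>
    using char_inner_sum_Irr[of "set xs" \<chi> ?f a, OF _ xs(1) that f] inner by simp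
  have Irr: "Irr G = set xs"
    using eq xs(1) Irr_one by (metis of_nat_0_eq_iff less_numeral_extra(3) subsetI subset_antisym)
  then show "finite (Irr G)" by simp
  assume "g \<in> carrier G"
  then show "(\<Sum>\<chi>\<in>Irr G. \<chi> \<one> * \<chi> g) = ?f g"
    using f eq Irr by simp
qed

section \<open>Class functions and the number of irreducible characters\<close>

lemma Irr_conj:
  assumes "\<chi> \<in> Irr G" "g \<in> carrier G" "h \<in> carrier G"
  shows "\<chi> (h \<otimes> g \<otimes> inv h) = \<chi> g"
proof -
  from assms(1) obtain n R where R: "irreducible_representation G n R" and \<chi>: "\<chi> = character G R"
    by (auto simp: Irr_def)
  note Rd = representationD[OF irreducible_representationD(1)[OF R]]
  have c: "R g \<in> carrier_mat n n" "R h \<in> carrier_mat n n" "R (inv h) \<in> carrier_mat n n"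
    using Rd(1) assms by auto
  have "mat_trace (R (h \<otimes> g \<otimes> inv h)) = mat_trace (R h * R g * R (inv h))"
    using assms by (simp add: Rd(2))
  also have "\<dots> = mat_trace (R (inv h) * (R h * R g))"
    using c by (intro mat_trace_comm) auto
  also have "R (inv h) * (R h * R g) = R (inv h) * R h * R g"
    using c by (intro assoc_mult_mat[symmetric]) auto
  also have "\<dots> = R g" using Rd(5)[OF assms(3)] c by simp
  finally show ?thesis using assms by (simp add: \<chi> character_def)
qed

text \<open>
  By Schur's lemma \<open>\<Sum>\<^sub>h f(h) R(h\<inverse>)\<close> is a scalar matrix.  Weighting the result by the degree and summing
  over \<open>\<chi>\<close> turns the left side into the convolution of \<open>f\<close> with the regular character, that is, a multiple of \<open>f\<close>.
\<close>

lemma class_function_convolution: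
  assumes f: "\<And>g h. g \<in> carrier G \<Longrightarrow> h \<in> carrier G \<Longrightarrow> f (h \<otimes> g \<otimes> inv h) = f g"
    and \<chi>: "\<chi> \<in> Irr G" and g: "g \<in> carrier G"
  shows "\<chi> \<one> * (\<Sum>h\<in>carrier G. f h * \<chi> (inv h \<otimes> g)) = of_nat (card (carrier G)) * char_inner f \<chi> * \<chi> g"
proof -
  from \<chi> obtain n R where R: "irreducible_representation G n R" and \<chi>R: "\<chi> = character G R"
    by (auto simp: Irr_def)
  note rep = irreducible_representationD[OF R]
  note Rd = representationD[OF rep(1)]
  let ?F = "\<lambda>h. f h \<cdot>\<^sub>m R (inv h)"
  define A where "A = mat_sum n n ?F (carrier G)"
  have F: "?F h \<in> carrier_mat n n" if "h \<in> carrier G" for h using Rd(1) that by simp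
  have A: "A \<in> carrier_mat n n" by (simp add: A_def)
  \<comment> \<open>Here \<open>f\<close> being a class function enters: replacing \<open>h\<close>
    by \<open>k \<otimes> h \<otimes> inv k\<close> permutes the summands and leaves the weights
    unchanged.\<close>
  have RA: "R k * A = A * R k" if k: "k \<in> carrier G" for k
  proof -
    have "R k * A = mat_sum n n (\<lambda>h. R k * ?F h) (carrier G)"
      unfolding A_def using Rd(1)[OF k] F by (rule mult_mat_sum)
    also have "\<dots> = mat_sum n n (\<lambda>h. ?F (k \<otimes> h \<otimes> inv k) * R k) (carrier G)"
    proof (rule mat_sum_cong)
      fix h assume h: "h \<in> carrier G"
      have inv: "inv (k \<otimes> h \<otimes> inv k) = k \<otimes> inv h \<otimes> inv k"
        using h k by (simp add: inv_mult_group m_assoc)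
      have "?F (k \<otimes> h \<otimes> inv k) * R k = f h \<cdot>\<^sub>m (R (k \<otimes> inv h \<otimes> inv k) * R k)"
        using Rd(1)[OF k] Rd(1)[of "k \<otimes> inv h \<otimes> inv k"] h k f[OF h k]
        by (simp add: inv mult_smult_assoc_mat[of _ n n _ n])
      also have "R (k \<otimes> inv h \<otimes> inv k) * R k = R (k \<otimes> inv h \<otimes> inv k \<otimes> k)"
        using h k by (simp add: Rd(2))
      also have "k \<otimes> inv h \<otimes> inv k \<otimes> k = k \<otimes> inv h" using h k by (simp add: m_assoc)
      also have "f h \<cdot>\<^sub>m R (k \<otimes> inv h) = R k * ?F h"
        using Rd(1)[OF k] Rd(1)[OF inv_closed[OF h]] h k
        by (simp add: Rd(2) mult_smult_distrib[of _ n n _ n])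
      finally show "R k * ?F h = ?F (k \<otimes> h \<otimes> inv k) * R k" by simp
    qed
    also have "\<dots> = mat_sum n n (\<lambda>h. ?F h * R k) (carrier G)"
      by (rule mat_sum_reindex[OF bij_betw_conj[OF k], of n n "\<lambda>h. ?F h * R k"])
    also have "\<dots> = A * R k"
      unfolding A_def using Rd(1)[OF k] F by (rule mat_sum_mult[symmetric])
    finally show ?thesis .
  qed
  define c where "c = mat_trace A / of_nat n"
  have Ac: "A = c \<cdot>\<^sub>m 1\<^sub>m n"
    unfolding c_def by (rule schur_scalar[OF is_group R A RA])
  have "mat_trace A = (\<Sum>h\<in>carrier G. mat_trace (?F h))"
    unfolding A_def by (rule mat_trace_mat_sum) (rule F)
  also have "\<dots> = (\<Sum>h\<in>carrier G. f h * \<chi> (inv h))"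
    by (rule sum.cong) (auto simp: \<chi>R character_def mat_trace_smult[of _ n] Rd(1))
  finally have trA: "mat_trace A = of_nat (card (carrier G)) * char_inner f \<chi>"
    using card_carrier_pos by (simp add: char_inner_def)
  have "(\<Sum>h\<in>carrier G. f h * \<chi> (inv h \<otimes> g)) = (\<Sum>h\<in>carrier G. mat_trace (?F h * R g))"
  proof (rule sum.cong)
    fix h assume h: "h \<in> carrier G"
    have "?F h * R g = f h \<cdot>\<^sub>m R (inv h \<otimes> g)"
      using Rd(1)[OF g] Rd(1)[OF inv_closed[OF h]] h g
      by (simp add: Rd(2) mult_smult_assoc_mat[of _ n n _ n])
    then show "f h * \<chi> (inv h \<otimes> g) = mat_trace (?F h * R g)"
      using h g Rd(1)[of "inv h \<otimes> g"] by (simp add: \<chi>R character_def mat_trace_smult[of _ n])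
  qed simp
  also have "\<dots> = mat_trace (mat_sum n n (\<lambda>h. ?F h * R g) (carrier G))"
    by (intro mat_trace_mat_sum[symmetric] mult_carrier_mat[OF F Rd(1)[OF g]])
  also have "mat_sum n n (\<lambda>h. ?F h * R g) (carrier G) = A * R g"
    unfolding A_def using Rd(1)[OF g] F by (rule mat_sum_mult[symmetric])
  also have "\<dots> = c \<cdot>\<^sub>m R g" unfolding Ac using Rd(1)[OF g] by (simp add: mult_smult_assoc_mat[of _ n n _ n])
  also have "mat_trace (c \<cdot>\<^sub>m R g) = c * \<chi> g"
    using Rd(1)[OF g] g by (simp add: \<chi>R character_def mat_trace_smult[of _ n])
  finally have "(\<Sum>h\<in>carrier G. f h * \<chi> (inv h \<otimes> g)) = c * \<chi> g" .
  moreover have "\<chi> \<one> = of_nat n" by (simp add: \<chi>R character_def Rd(3))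
  ultimately show ?thesis using trA rep(2) by (simp add: c_def)
qed

lemma class_function_expansion:
  assumes f: "\<And>g h. g \<in> carrier G \<Longrightarrow> h \<in> carrier G \<Longrightarrow> f (h \<otimes> g \<otimes> inv h) = f g"
    and g: "g \<in> carrier G"
  shows "f g = (\<Sum>\<chi>\<in>Irr G. char_inner f \<chi> * \<chi> g)"
proof -
  let ?N = "of_nat (card (carrier G)) :: complex"
  have "(\<Sum>h\<in>carrier G. f h * (if inv h \<otimes> g = \<one> then ?N else 0)) = (\<Sum>h\<in>{g}. f h * ?N)"
  proof (rule sum.mono_neutral_cong_right)
    show "\<forall>h\<in>carrier G - {g}. f h * (if inv h \<otimes> g = \<one> then ?N else 0) = 0"
      using g by (auto simp: inv_equality[symmetric] dest: inv_unique')
        (metis inv_equality inv_closed inv_inv)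
  qed (use g in auto)
  then have "f g * ?N = (\<Sum>h\<in>carrier G. f h * (\<Sum>\<chi>\<in>Irr G. \<chi> \<one> * \<chi> (inv h \<otimes> g)))"
    using g by (simp add: sum_Irr_degree)
  also have "\<dots> = (\<Sum>\<chi>\<in>Irr G. \<chi> \<one> * (\<Sum>h\<in>carrier G. f h * \<chi> (inv h \<otimes> g)))"
    unfolding sum_distrib_left by (subst sum.swap) (simp add: mult.left_commute)
  also have "\<dots> = (\<Sum>\<chi>\<in>Irr G. ?N * char_inner f \<chi> * \<chi> g)"
    using class_function_convolution[OF f _ g] by (intro sum.cong) auto
  also have "\<dots> = (\<Sum>\<chi>\<in>Irr G. char_inner f \<chi> * \<chi> g) * ?N"
    by (simp add: sum_distrib_left mult_ac)
  finally show ?thesis using card_carrier_pos by simp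
qed

text \<open>
  Expanding the indicator of the class of \<open>h\<close> gives \<open>\<Sum>\<^sub>\<chi> \<chi>(h) \<chi>(h\<inverse>) = |G| / |cl(h)|\<close>.  Summed over \<open>h\<close>, the left
  side is \<open>|G| |Irr G|\<close> and the right side counts every class \<open>|G|\<close> times.
\<close>

lemma card_Irr: "card (Irr G) = class_number G"
proof -
  let ?N = "of_nat (card (carrier G)) :: complex"
  let ?\<phi> = "\<lambda>g. \<lambda>x\<in>carrier G. g \<otimes> x \<otimes> inv g"
  interpret conj: group_action G "carrier G" ?\<phi> by (rule action_by_conjugation)
  define cl where "cl = orbit G ?\<phi>"
  have cl_def': "cl h = {k \<otimes> h \<otimes> inv k | k. k \<in> carrier G}" if "h \<in> carrier G" for h
    using that by (auto simp: cl_def orbit_def)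
  have cl_sub: "cl h \<subseteq> carrier G" if "h \<in> carrier G" for h using that by (auto simp: cl_def')
  have fin: "finite (cl h)" if "h \<in> carrier G" for h
    using cl_sub[OF that] finite_carrier finite_subset by blast
  have self: "h \<in> cl h" if "h \<in> carrier G" for h
    using conj.orbit_refl[OF that] by (simp add: cl_def)
  have pos: "card (cl h) > 0" if "h \<in> carrier G" for h
    using self[OF that] fin[OF that] card_gt_0_iff by blast
  have col: "(\<Sum>\<chi>\<in>Irr G. \<chi> h * \<chi> (inv h)) = ?N / of_nat (card (cl h))" if h: "h \<in> carrier G" for h
  proof -
    let ?f = "\<lambda>g. if g \<in> cl h then 1 else 0 :: complex"
    \<comment> \<open>Makes the indicator of the class a class function; both directions are
      symmetry and transitivity of orbits.\<close>
    have conj_iff: "k \<otimes> g \<otimes> inv k \<in> cl h \<longleftrightarrow> g \<in> cl h" if g: "g \<in> carrier G" and k: "k \<in> carrier G" for g k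
    proof -
      have gk: "k \<otimes> g \<otimes> inv k \<in> cl g" using g k by (auto simp: cl_def')
      have "g \<in> cl (k \<otimes> g \<otimes> inv k)"
        using conj.orbit_sym[of g "k \<otimes> g \<otimes> inv k"] gk g k by (simp add: cl_def)
      then show ?thesis
        using gk conj.orbit_trans[of h g "k \<otimes> g \<otimes> inv k"] conj.orbit_trans[of h "k \<otimes> g \<otimes> inv k" g] g h k
        by (auto simp: cl_def)
    qed
    have "char_inner ?f \<chi> = of_nat (card (cl h)) / ?N * \<chi> (inv h)" if \<chi>: "\<chi> \<in> Irr G" for \<chi>
    proof -
      have "(\<Sum>g\<in>carrier G. ?f g * \<chi> (inv g)) = (\<Sum>g\<in>cl h. \<chi> (inv h))"
      proof (rule sum.mono_neutral_cong_right)
        fix g assume "g \<in> cl h"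
        then obtain k where k: "k \<in> carrier G" "g = k \<otimes> h \<otimes> inv k" using cl_def'[OF h] by auto
        have "inv g = k \<otimes> inv h \<otimes> inv k" using k h by (simp add: inv_mult_group m_assoc)
        then show "?f g * \<chi> (inv g) = \<chi> (inv h)"
          using \<open>g \<in> cl h\<close> Irr_conj[OF \<chi>, of "inv h" k] k h by simp
      qed (use cl_sub[OF h] in auto)
      then show ?thesis by (simp add: char_inner_def)
    qed
    then have "?f h = (\<Sum>\<chi>\<in>Irr G. of_nat (card (cl h)) / ?N * \<chi> (inv h) * \<chi> h)"
      using class_function_expansion[of ?f h] conj_iff h by simp
    then have "1 = of_nat (card (cl h)) / ?N * (\<Sum>\<chi>\<in>Irr G. \<chi> h * \<chi> (inv h))"
      using self[OF h] by (simp add: sum_distrib_left mult_ac)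
    then show ?thesis using pos[OF h] card_carrier_pos by (simp add: field_simps)
  qed
  have "?N * of_nat (card (Irr G)) = (\<Sum>\<chi>\<in>Irr G. ?N * char_inner \<chi> \<chi>)"
    by (simp add: char_inner_Irr)
  also have "\<dots> = (\<Sum>\<chi>\<in>Irr G. \<Sum>h\<in>carrier G. \<chi> h * \<chi> (inv h))"
    using card_carrier_pos by (simp add: char_inner_def)
  also have "\<dots> = (\<Sum>h\<in>carrier G. ?N / of_nat (card (cl h)))"
    by (subst sum.swap) (simp add: col)
  also have "\<dots> = (\<Sum>orb\<in>orbits G (carrier G) ?\<phi>. \<Sum>h\<in>orb. ?N / of_nat (card (cl h)))"
    by (rule conj.disjoint_sum[symmetric]) simp
  also have "\<dots> = (\<Sum>orb\<in>orbits G (carrier G) ?\<phi>. ?N)"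
  proof (rule sum.cong)
    fix orb assume orb: "orb \<in> orbits G (carrier G) ?\<phi>"
    then obtain x where x: "x \<in> carrier G" "orb = cl x" by (auto simp: orbits_def cl_def)
    have "cl h = orb" if "h \<in> orb" for h
    proof -
      have "h \<in> carrier G" using cl_sub x that by auto
      then have "cl h \<in> orbits G (carrier G) ?\<phi>" "h \<in> cl h \<inter> orb"
        using self that by (auto simp: orbits_def cl_def)
      then show ?thesis using conj.disjoint_union[of "cl h" orb] orb by auto
    qed
    then show "(\<Sum>h\<in>orb. ?N / of_nat (card (cl h))) = ?N"
      using pos[OF x(1)] x(2) by simp
  qed simp
  finally have "?N * of_nat (card (Irr G)) = ?N * of_nat (class_number G)"
    by (simp add: class_number_def)
  then show ?thesis using card_carrier_pos by simp
qed

section \<open>Induction and restriction\<close>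

lemma finite_group_subgroup:
  assumes "subgroup H G"
  shows "finite_group (G\<lparr>carrier := H\<rparr>)"
proof -
  have "finite H" using assms finite_carrier by (meson finite_subset subgroup.subset)
  then show ?thesis
    using subgroup_imp_group[OF assms] by (simp add: finite_group_def finite_group_axioms_def)
qed

text \<open>Extending \<pi> by zero lets the sum run over the whole group, where translations and
  conjugations simply permute the index set.\<close>

lemma induced_character_eq:
  assumes "g \<in> carrier G"
  shows "induced_character G H \<pi> g = (\<Sum>x\<in>carrier G.
    if inv x \<otimes> g \<otimes> x \<in> H then \<pi> (inv x \<otimes> g \<otimes> x) else 0) / of_nat (card H)"
proof -
  have "{x. x \<in> carrier G \<and> inv x \<otimes> g \<otimes> x \<in> H} = {x \<in> carrier G. inv x \<otimes> g \<otimes> x \<in> H}" by auto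
  then show ?thesis using assms by (simp add: induced_character_def sum.inter_filter)
qed

lemma induced_character_conj:
  assumes g: "g \<in> carrier G" and k: "k \<in> carrier G"
  shows "induced_character G H \<pi> (k \<otimes> g \<otimes> inv k) = induced_character G H \<pi> g"
proof -
  let ?F = "\<lambda>y. if y \<in> H then \<pi> y else 0"
  have "(\<Sum>x\<in>carrier G. ?F (inv x \<otimes> (k \<otimes> g \<otimes> inv k) \<otimes> x))
      = (\<Sum>x\<in>carrier G. ?F (inv (k \<otimes> x) \<otimes> (k \<otimes> g \<otimes> inv k) \<otimes> (k \<otimes> x)))"
    by (rule sum.reindex_bij_betw[OF bij_betw_mult_left[OF k], symmetric])
  also have "\<dots> = (\<Sum>x\<in>carrier G. ?F (inv x \<otimes> g \<otimes> x))"
  proof (rule sum.cong)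
    fix x assume x: "x \<in> carrier G"
    have "inv (k \<otimes> x) \<otimes> (k \<otimes> g \<otimes> inv k) \<otimes> (k \<otimes> x) = inv x \<otimes> g \<otimes> x"
      using g k x by (simp add: inv_mult_group m_assoc)
    then show "?F (inv (k \<otimes> x) \<otimes> (k \<otimes> g \<otimes> inv k) \<otimes> (k \<otimes> x)) = ?F (inv x \<otimes> g \<otimes> x)" by simp
  qed simp
  finally show ?thesis using g k by (simp add: induced_character_eq)
qed

text \<open>After exchanging the sums, put \<open>g = x \<otimes> h \<otimes> inv x\<close> for
  fixed \<open>x\<close>. As \<chi> is a class function the inner sum no longer depends on
  \<open>x\<close>, and the |G| equal terms cancel the normalisation. On the right \<chi> needs no
  explicit restriction, since the inner product over \<open>H\<close> reads only its values on
  \<open>H\<close>.\<close>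

lemma frobenius_reciprocity:
  assumes H: "subgroup H G" and \<chi>: "\<chi> \<in> Irr G"
  shows "char_inner (induced_character G H \<pi>) \<chi> = finite_group.char_inner (G\<lparr>carrier := H\<rparr>) \<pi> \<chi>"
proof -
  interpret K: finite_group "G\<lparr>carrier := H\<rparr>" by (rule finite_group_subgroup[OF H])
  let ?N = "of_nat (card (carrier G)) :: complex"
  have HG: "H \<subseteq> carrier G" using H by (rule subgroup.subset)
  let ?F = "\<lambda>x g. if inv x \<otimes> g \<otimes> x \<in> H then \<pi> (inv x \<otimes> g \<otimes> x) * \<chi> (inv g) else 0"
  have "?N * of_nat (card H) * char_inner (induced_character G H \<pi>) \<chi>
      = (\<Sum>g\<in>carrier G. \<Sum>x\<in>carrier G. ?F x g)"
    using card_carrier_pos K.card_carrier_pos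
    by (auto simp: char_inner_def induced_character_eq sum_distrib_right sum_divide_distrib[symmetric]
        intro!: sum.cong)
  also have "\<dots> = (\<Sum>x\<in>carrier G. \<Sum>g\<in>carrier G. ?F x g)"
    by (rule sum.swap)
  also have "\<dots> = (\<Sum>x\<in>carrier G. \<Sum>h\<in>H. \<pi> h * \<chi> (inv h))"
  proof (rule sum.cong)
    fix x assume x: "x \<in> carrier G"
    have "(\<Sum>g\<in>carrier G. ?F x g) = (\<Sum>h\<in>carrier G. ?F x (x \<otimes> h \<otimes> inv x))"
      by (rule sum.reindex_bij_betw[OF bij_betw_conj[OF x], symmetric])
    also have "\<dots> = (\<Sum>h\<in>carrier G. if h \<in> H then \<pi> h * \<chi> (inv h) else 0)"
    proof (rule sum.cong)
      fix h assume h: "h \<in> carrier G"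
      have 1: "inv x \<otimes> (x \<otimes> h \<otimes> inv x) \<otimes> x = h" using x h by (simp add: m_assoc)
      have 2: "inv (x \<otimes> h \<otimes> inv x) = x \<otimes> inv h \<otimes> inv x" using x h by (simp add: inv_mult_group m_assoc)
      show "?F x (x \<otimes> h \<otimes> inv x) = (if h \<in> H then \<pi> h * \<chi> (inv h) else 0)"
        unfolding 1 2 using Irr_conj[OF \<chi>, of "inv h" x] x h by simp
    qed simp
    also have "\<dots> = (\<Sum>h\<in>H. \<pi> h * \<chi> (inv h))"
      using HG by (intro sum.mono_neutral_cong_right) auto
    finally show "(\<Sum>g\<in>carrier G. ?F x g) = (\<Sum>h\<in>H. \<pi> h * \<chi> (inv h))" .
  qed simp
  also have "\<dots> = ?N * (\<Sum>h\<in>H. \<pi> h * \<chi> (inv\<^bsub>G\<lparr>carrier := H\<rparr>\<^esub> h))"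
    using H by simp
  also have "\<dots> = ?N * of_nat (card H) * K.char_inner \<pi> \<chi>"
    using K.card_carrier_pos by (simp add: K.char_inner_def)
  finally show ?thesis
    using card_carrier_pos K.card_carrier_pos by simp
qed

lemma restricted_character_expansion:
  assumes H: "subgroup H G" and \<rho>: "\<rho> \<in> Irr G" and h: "h \<in> H"
  shows "\<rho> h = (\<Sum>\<pi>\<in>Irr (G\<lparr>carrier := H\<rparr>).
    finite_group.char_inner (G\<lparr>carrier := H\<rparr>) \<pi> \<rho> * \<pi> h)"
proof -
  interpret K: finite_group "G\<lparr>carrier := H\<rparr>" by (rule finite_group_subgroup[OF H])
  have HG: "H \<subseteq> carrier G" using H by (rule subgroup.subset)
  have "\<rho> h = (\<Sum>\<pi>\<in>Irr (G\<lparr>carrier := H\<rparr>). K.char_inner \<rho> \<pi> * \<pi> h)"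
  proof (rule K.class_function_expansion)
    fix g k assume "g \<in> carrier (G\<lparr>carrier := H\<rparr>)" "k \<in> carrier (G\<lparr>carrier := H\<rparr>)"
    then show "\<rho> (k \<otimes>\<^bsub>G\<lparr>carrier := H\<rparr>\<^esub> g \<otimes>\<^bsub>G\<lparr>carrier := H\<rparr>\<^esub> inv\<^bsub>G\<lparr>carrier := H\<rparr>\<^esub> k) = \<rho> g"
      using HG H Irr_conj[OF \<rho>, of g k] by auto
  qed (use h in simp)
  then show ?thesis by (simp add: K.char_inner_commute[of \<rho>])
qed

text \<open>Restricting a representation to \<open>H\<close> gives a representation of
  \<open>H\<close>, and complete reducibility makes the inner product a count of constituents. Via
  Frobenius reciprocity this is the source of integrality for induced characters.\<close>

lemma restricted_character_inner_nat:
  assumes H: "subgroup H G" and \<rho>: "\<rho> \<in> Irr G" and \<pi>: "\<pi> \<in> Irr (G\<lparr>carrier := H\<rparr>)"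
  shows "\<exists>n :: nat. finite_group.char_inner (G\<lparr>carrier := H\<rparr>) \<pi> \<rho> = of_nat n"
proof -
  interpret K: finite_group "G\<lparr>carrier := H\<rparr>" by (rule finite_group_subgroup[OF H])
  have HG: "H \<subseteq> carrier G" using H by (rule subgroup.subset)
  from \<rho> obtain n R where "irreducible_representation G n R" and \<rho>R: "\<rho> = character G R"
    by (auto simp: Irr_def)
  then have "representation G n R" by (simp add: irreducible_representationD)
  then have "representation (G\<lparr>carrier := H\<rparr>) n R"
    using HG by (auto simp: representation_iff[OF is_group] representation_iff[OF K.is_group])
  then obtain xs where xs: "set xs \<subseteq> Irr (G\<lparr>carrier := H\<rparr>)"
    "\<forall>h\<in>carrier (G\<lparr>carrier := H\<rparr>). mat_trace (R h) = (\<Sum>\<pi>\<leftarrow>xs. \<pi> h)"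
    using K.character_sum_list_Irr by blast
  have "\<rho> h = (\<Sum>\<pi>\<in>Irr (G\<lparr>carrier := H\<rparr>). of_nat (count_list xs \<pi>) * \<pi> h)" if h: "h \<in> H" for h
  proof -
    have "\<rho> h = mat_trace (R h)" using h HG by (auto simp: \<rho>R character_def)
    then show ?thesis
      using xs(2) h sum_list_map_eq_sum_of_nat_count[OF K.finite_Irr xs(1), of "\<lambda>\<pi>. \<pi> h"] by simp
  qed
  then have "K.char_inner \<rho> \<pi> = of_nat (count_list xs \<pi>)"
    using K.char_inner_sum_Irr[of "Irr (G\<lparr>carrier := H\<rparr>)" \<pi> \<rho> "\<lambda>\<pi>. of_nat (count_list xs \<pi>)"] \<pi>
    by simp
  then show ?thesis unfolding K.char_inner_commute[of \<pi> \<rho>] by (rule exI)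
qed

text \<open>Evaluates the definite description in \<open>multiplicities\<close>: orthogonality makes
  the coefficients unique on \<open>Irr G\<close>, and \<open>extensional\<close> fixes the values
  elsewhere, about which the decomposition says nothing.\<close>

lemma multiplicities_eq:
  assumes \<psi>: "\<And>g. g \<in> carrier G \<Longrightarrow> \<psi> g = (\<Sum>\<chi>\<in>Irr G. of_nat (m \<chi>) * \<chi> g)" and \<chi>: "\<chi> \<in> Irr G"
  shows "multiplicities G \<psi> \<chi> = m \<chi>"
proof -
  have "multiplicities G \<psi> = restrict m (Irr G)"
    unfolding multiplicities_def
  proof (rule the_equality)
    show "restrict m (Irr G) \<in> extensional (Irr G) \<and>
        (\<forall>g\<in>carrier G. \<psi> g = (\<Sum>\<chi>\<in>Irr G. of_nat (restrict m (Irr G) \<chi>) * \<chi> g))"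
      using \<psi> by simp
  next
    fix m' assume m': "m' \<in> extensional (Irr G) \<and> (\<forall>g\<in>carrier G. \<psi> g = (\<Sum>\<chi>\<in>Irr G. of_nat (m' \<chi>) * \<chi> g))"
    have "m' \<theta> = m \<theta>" if \<theta>: "\<theta> \<in> Irr G" for \<theta>
    proof -
      have "of_nat (m' \<theta>) = char_inner \<psi> \<theta>" "of_nat (m \<theta>) = char_inner \<psi> \<theta>"
        using char_inner_sum_Irr[of "Irr G" \<theta> \<psi> "\<lambda>\<chi>. of_nat (m' \<chi>)"]
          char_inner_sum_Irr[of "Irr G" \<theta> \<psi> "\<lambda>\<chi>. of_nat (m \<chi>)"] m' \<psi> \<theta> by auto
      then have "(of_nat (m' \<theta>) :: complex) = of_nat (m \<theta>)" by simp
      then show ?thesis by (simp only: of_nat_eq_iff)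
    qed
    then show "m' = restrict m (Irr G)"
      using m' by (intro extensionalityI[of _ "Irr G"]) auto
  qed
  then show ?thesis using \<chi> by simp
qed

text \<open>The induced character is a class function, so it expands in \<open>Irr G\<close>;
  reciprocity moves the coefficients to \<open>H\<close>, where they are natural numbers. The first
  part is the bridge to restrictions: the same inner products are the coefficients of \<rho> on
  \<open>H\<close>.\<close>

lemma induced_character_decomposition:
  assumes H: "subgroup H G" and \<pi>: "\<pi> \<in> Irr (G\<lparr>carrier := H\<rparr>)"
  shows "\<rho> \<in> Irr G \<Longrightarrow>
      of_nat (induced_multiplicity G H \<rho> \<pi>) = finite_group.char_inner (G\<lparr>carrier := H\<rparr>) \<pi> \<rho>"
    and "g \<in> carrier G \<Longrightarrow>
      induced_character G H \<pi> g = (\<Sum>\<rho>\<in>Irr G. of_nat (induced_multiplicity G H \<rho> \<pi>) * \<rho> g)"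
proof -
  let ?c = "finite_group.char_inner (G\<lparr>carrier := H\<rparr>) \<pi>"
  have "\<forall>\<rho>\<in>Irr G. \<exists>n :: nat. ?c \<rho> = of_nat n"
    using restricted_character_inner_nat[OF H _ \<pi>] by blast
  then obtain m :: "('a \<Rightarrow> complex) \<Rightarrow> nat" where m: "\<And>\<rho>. \<rho> \<in> Irr G \<Longrightarrow> ?c \<rho> = of_nat (m \<rho>)"
    by metis
  have ind: "induced_character G H \<pi> g = (\<Sum>\<rho>\<in>Irr G. of_nat (m \<rho>) * \<rho> g)" if g: "g \<in> carrier G" for g
  proof -
    have "induced_character G H \<pi> g = (\<Sum>\<rho>\<in>Irr G. char_inner (induced_character G H \<pi>) \<rho> * \<rho> g)"
      by (rule class_function_expansion[OF induced_character_conj g])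
    then show ?thesis by (simp add: frobenius_reciprocity[OF H] m)
  qed
  have mult: "induced_multiplicity G H \<rho> \<pi> = m \<rho>" if "\<rho> \<in> Irr G" for \<rho>
    unfolding induced_multiplicity_def by (rule multiplicities_eq[OF ind that])
  show "\<rho> \<in> Irr G \<Longrightarrow> of_nat (induced_multiplicity G H \<rho> \<pi>) = ?c \<rho>"
    by (simp add: mult m)
  show "g \<in> carrier G \<Longrightarrow>
      induced_character G H \<pi> g = (\<Sum>\<rho>\<in>Irr G. of_nat (induced_multiplicity G H \<rho> \<pi>) * \<rho> g)"
    by (simp add: mult ind)
qed

lemma restricted_character_decomposition:
  assumes H: "subgroup H G" and \<rho>: "\<rho> \<in> Irr G" and h: "h \<in> H"
  shows "\<rho> h = (\<Sum>\<pi>\<in>Irr (G\<lparr>carrier := H\<rparr>). of_nat (induced_multiplicity G H \<rho> \<pi>) * \<pi> h)"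
  unfolding restricted_character_expansion[OF H \<rho> h]
  by (rule sum.cong) (simp_all add: induced_character_decomposition(1)[OF H _ \<rho>])

section \<open>Degrees and the two bounds\<close>

text \<open>A member of \<open>Irr G\<close> is a bare function that no longer carries a matrix
  size, so the dimension is recovered from its value at the identity, as a natural number fit for
  inequalities.\<close>

definition degree :: "('a \<Rightarrow> complex) \<Rightarrow> nat"
  where "degree \<chi> = (THE d. \<chi> \<one> = of_nat d)"

lemma degree:
  assumes "\<chi> \<in> Irr G"
  shows "\<chi> \<one> = of_nat (degree \<chi>)" "degree \<chi> > 0"
proof -
  obtain d :: nat where d: "d > 0" "\<chi> \<one> = of_nat d" using Irr_one[OF assms] .
  have "degree \<chi> = d" unfolding degree_def using d by (intro the_equality) auto
  with d show "\<chi> \<one> = of_nat (degree \<chi>)" "degree \<chi> > 0" by auto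
qed

text \<open>This is the decomposition of the regular character evaluated at the identity.\<close>

lemma sum_degree_squared: "(\<Sum>\<chi>\<in>Irr G. (degree \<chi>)\<^sup>2) = card (carrier G)"
proof -
  have "(of_nat (\<Sum>\<chi>\<in>Irr G. (degree \<chi>)\<^sup>2) :: complex) = (\<Sum>\<chi>\<in>Irr G. \<chi> \<one> * \<chi> \<one>)"
    by (simp add: degree(1) power2_eq_square)
  then have "(of_nat (\<Sum>\<chi>\<in>Irr G. (degree \<chi>)\<^sup>2) :: complex) = of_nat (card (carrier G))"
    by (simp add: sum_Irr_degree)
  then show ?thesis by (simp only: of_nat_eq_iff)
qed

lemma Irr_nonempty [simp]: "Irr G \<noteq> {}"
  using sum_degree_squared card_carrier_pos by auto

lemma sum_degree_squared_le: "(\<Sum>\<chi>\<in>Irr G. real (degree \<chi>))\<^sup>2 \<le> real (class_number G) * real (card (carrier G))"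
proof -
  have "(\<Sum>\<chi>\<in>Irr G. real (degree \<chi>))\<^sup>2 \<le> (\<Sum>\<chi>\<in>Irr G. (real (degree \<chi>))\<^sup>2) * card (Irr G)"
    by (rule sum_squared_le_sum_of_squares)
  also have "(\<Sum>\<chi>\<in>Irr G. (real (degree \<chi>))\<^sup>2) = real (card (carrier G))"
    unfolding sum_degree_squared[symmetric] by simp
  finally show ?thesis by (simp add: card_Irr mult.commute)
qed

lemma sum_induced_multiplicity_degree:
  assumes H: "subgroup H G" and \<pi>: "\<pi> \<in> Irr (G\<lparr>carrier := H\<rparr>)"
  shows "(\<Sum>\<rho>\<in>Irr G. induced_multiplicity G H \<rho> \<pi> * degree \<rho>)
    = card (rcosets H) * finite_group.degree (G\<lparr>carrier := H\<rparr>) \<pi>"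
proof -
  interpret K: finite_group "G\<lparr>carrier := H\<rparr>" by (rule finite_group_subgroup[OF H])
  have N: "card (carrier G) = card (rcosets H) * card H"
    using lagrange[OF H] by (simp add: Coset.order_def)
  have "\<one> \<in> H" using H by (rule subgroup.one_closed)
  \<comment> \<open>Every conjugate of the identity lies in \<open>H\<close>, so all |G| summands
    are present and equal.\<close>
  then have "induced_character G H \<pi> \<one> = of_nat (card (carrier G)) * \<pi> \<one> / of_nat (card H)"
    by (simp add: induced_character_eq)
  also have "\<dots> = of_nat (card (rcosets H)) * of_nat (K.degree \<pi>)"
    using K.degree(1)[OF \<pi>] K.card_carrier_pos by (simp add: N)
  finally have "(of_nat (\<Sum>\<rho>\<in>Irr G. induced_multiplicity G H \<rho> \<pi> * degree \<rho>) :: complex)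
      = of_nat (card (rcosets H) * K.degree \<pi>)"
    using induced_character_decomposition(2)[OF H \<pi> one_closed] by (simp add: degree(1))
  then show ?thesis by (simp only: of_nat_eq_iff)
qed

lemma degree_eq_sum_induced_multiplicity:
  assumes H: "subgroup H G" and \<rho>: "\<rho> \<in> Irr G"
  shows "degree \<rho> = (\<Sum>\<pi>\<in>Irr (G\<lparr>carrier := H\<rparr>).
    induced_multiplicity G H \<rho> \<pi> * finite_group.degree (G\<lparr>carrier := H\<rparr>) \<pi>)"
proof -
  interpret K: finite_group "G\<lparr>carrier := H\<rparr>" by (rule finite_group_subgroup[OF H])
  have "\<pi> \<one> = of_nat (K.degree \<pi>)" if "\<pi> \<in> Irr (G\<lparr>carrier := H\<rparr>)" for \<pi>
    using K.degree(1)[OF that] by simp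
  then have "(of_nat (degree \<rho>) :: complex) = of_nat (\<Sum>\<pi>\<in>Irr (G\<lparr>carrier := H\<rparr>).
      induced_multiplicity G H \<rho> \<pi> * K.degree \<pi>)"
    using restricted_character_decomposition[OF H \<rho> subgroup.one_closed[OF H]] degree(1)[OF \<rho>] by simp
  then show ?thesis by (simp only: of_nat_eq_iff)
qed

lemma induced_multiplicity_squared_le:
  assumes H: "subgroup H G" and \<rho>: "\<rho> \<in> Irr G" and \<pi>: "\<pi> \<in> Irr (G\<lparr>carrier := H\<rparr>)"
  shows "(induced_multiplicity G H \<rho> \<pi>)\<^sup>2 \<le> card (rcosets H)"
proof -
  interpret K: finite_group "G\<lparr>carrier := H\<rparr>" by (rule finite_group_subgroup[OF H])
  let ?c = "induced_multiplicity G H \<rho> \<pi>"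
  have "?c * degree \<rho> \<le> card (rcosets H) * K.degree \<pi>"
    unfolding sum_induced_multiplicity_degree[OF H \<pi>, symmetric]
    using member_le_sum[OF \<rho>, of "\<lambda>\<rho>. induced_multiplicity G H \<rho> \<pi> * degree \<rho>"] by simp
  moreover have "?c * K.degree \<pi> \<le> degree \<rho>"
    unfolding degree_eq_sum_induced_multiplicity[OF H \<rho>]
    using member_le_sum[OF \<pi>, of "\<lambda>\<pi>. induced_multiplicity G H \<rho> \<pi> * K.degree \<pi>"] by simp
  ultimately have "(?c * degree \<rho>) * (?c * K.degree \<pi>) \<le> (card (rcosets H) * K.degree \<pi>) * degree \<rho>"
    by (rule mult_le_mono)
  then have "(?c\<^sup>2) * (degree \<rho> * K.degree \<pi>) \<le> card (rcosets H) * (degree \<rho> * K.degree \<pi>)"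
    by (simp add: power2_eq_square mult_ac)
  then show ?thesis using degree(2)[OF \<rho>] K.degree(2)[OF \<pi>] by simp
qed

end

theorem theorem1p3:
  fixes G :: "('a, 'b) monoid_scheme" and H :: "'a set"
  assumes "group G" and "finite (carrier G)" and "subgroup H G"
  shows "1 / (sqrt (real (class_number (G\<lparr>carrier := H\<rparr>))) * sqrt (real (class_number G)))
             * sqrt (real (card (rcosets\<^bsub>G\<^esub> H)))
           \<le> real (largest_induced_multiplicity G H)
       \<and> real (largest_induced_multiplicity G H) \<le> sqrt (real (card (rcosets\<^bsub>G\<^esub> H)))"
proof -
  interpret finite_group G using assms by (simp add: finite_group_def finite_group_axioms_def)
  note H = assms(3)
  let ?K = "G\<lparr>carrier := H\<rparr>"
  interpret K: finite_group ?K by (rule finite_group_subgroup[OF H])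
  let ?c = "induced_multiplicity G H"
  define C where "C = largest_induced_multiplicity G H"
  define I where "I = card (rcosets\<^bsub>G\<^esub> H)"
  have C_Max: "C = Max ((\<lambda>\<rho>. Max (?c \<rho> ` Irr ?K)) ` Irr G)"
    by (simp add: C_def largest_induced_multiplicity_def)
  have c_le: "?c \<rho> \<pi> \<le> C" if "\<rho> \<in> Irr G" "\<pi> \<in> Irr ?K" for \<rho> \<pi>
  proof -
    have "?c \<rho> \<pi> \<le> Max (?c \<rho> ` Irr ?K)" using that by simp
    also have "\<dots> \<le> C" unfolding C_Max using that by simp
    finally show ?thesis .
  qed
  \<comment> \<open>Both maxima range over finite nonempty sets, so \<open>C\<close> is attained by
    some pair and inherits the bound proved for each single multiplicity.\<close>
  have "C \<in> (\<lambda>\<rho>. Max (?c \<rho> ` Irr ?K)) ` Irr G" unfolding C_Max by (rule Max_in) auto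
  then obtain \<rho> where \<rho>: "\<rho> \<in> Irr G" "C = Max (?c \<rho> ` Irr ?K)" by auto
  have "C \<in> ?c \<rho> ` Irr ?K" unfolding \<rho>(2) by (rule Max_in) auto
  then obtain \<pi> where \<pi>: "\<pi> \<in> Irr ?K" "C = ?c \<rho> \<pi>" by auto
  have "C\<^sup>2 \<le> I"
    using induced_multiplicity_squared_le[OF H \<rho>(1) \<pi>(1)] by (simp add: \<pi>(2) I_def)
  then have "(real C)\<^sup>2 \<le> real I" by (metis of_nat_le_iff of_nat_power)
  then have upper: "real C \<le> sqrt (real I)" by (rule real_le_rsqrt)
  have N: "card (carrier G) = I * card H"
    using lagrange[OF H] by (simp add: Coset.order_def I_def)
  have Hpos: "card H > 0" using K.card_carrier_pos by simp
  have Ipos: "I > 0" using card_carrier_pos N by (cases I) auto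
  have "I * card H = (\<Sum>\<pi>\<in>Irr ?K. I * K.degree \<pi> * K.degree \<pi>)"
    using K.sum_degree_squared by (simp add: power2_eq_square mult.assoc flip: sum_distrib_left)
  also have "\<dots> = (\<Sum>\<pi>\<in>Irr ?K. (\<Sum>\<rho>\<in>Irr G. ?c \<rho> \<pi> * degree \<rho>) * K.degree \<pi>)"
    unfolding I_def by (rule sum.cong) (simp_all add: sum_induced_multiplicity_degree[OF H])
  also have "\<dots> \<le> (\<Sum>\<pi>\<in>Irr ?K. (\<Sum>\<rho>\<in>Irr G. C * degree \<rho>) * K.degree \<pi>)"
    by (intro sum_mono mult_right_mono c_le) auto
  also have "\<dots> = C * (\<Sum>\<rho>\<in>Irr G. degree \<rho>) * (\<Sum>\<pi>\<in>Irr ?K. K.degree \<pi>)"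
    by (simp add: sum_distrib_left sum_distrib_right mult_ac)
  finally have "real (I * card H) \<le> real (C * (\<Sum>\<rho>\<in>Irr G. degree \<rho>) * (\<Sum>\<pi>\<in>Irr ?K. K.degree \<pi>))"
    by (simp only: of_nat_le_iff)
  then have "real I * real (card H)
      \<le> real C * (\<Sum>\<rho>\<in>Irr G. real (degree \<rho>)) * (\<Sum>\<pi>\<in>Irr ?K. real (K.degree \<pi>))"
    by simp
  \<comment> \<open>Squaring matches the squared form of Cauchy--Schwarz and postpones square roots
    to the end. Since |G| is \<open>I * card H\<close>, both sides then share the factor
    \<open>I\<close> times the square of \<open>card H\<close>; cancelling it leaves exactly one
    \<open>I\<close> on the left.\<close>
  then have "(real I * real (card H))\<^sup>2
      \<le> (real C * (\<Sum>\<rho>\<in>Irr G. real (degree \<rho>)) * (\<Sum>\<pi>\<in>Irr ?K. real (K.degree \<pi>)))\<^sup>2"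
    by (rule power_mono) simp
  also have "\<dots> = (real C)\<^sup>2 * ((\<Sum>\<rho>\<in>Irr G. real (degree \<rho>))\<^sup>2 * (\<Sum>\<pi>\<in>Irr ?K. real (K.degree \<pi>))\<^sup>2)"
    by (simp add: power_mult_distrib)
  also have "\<dots> \<le> (real C)\<^sup>2 * ((real (class_number G) * real (card (carrier G)))
      * (real (class_number ?K) * real (card H)))"
    using sum_degree_squared_le K.sum_degree_squared_le
    by (intro mult_left_mono mult_mono) auto
  finally have "real I * (real I * (real (card H))\<^sup>2)
      \<le> ((real C)\<^sup>2 * (real (class_number G) * real (class_number ?K))) * (real I * (real (card H))\<^sup>2)"
    by (simp add: N power2_eq_square mult_ac)
  then have "real I \<le> (real C)\<^sup>2 * (real (class_number G) * real (class_number ?K))"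
    using Ipos Hpos by (subst (asm) mult_le_cancel_right_pos) auto
  then have "sqrt (real I) \<le> sqrt ((real C)\<^sup>2 * (real (class_number G) * real (class_number ?K)))"
    by (rule real_sqrt_le_mono)
  also have "\<dots> = real C * (sqrt (real (class_number ?K)) * sqrt (real (class_number G)))"
    by (simp add: real_sqrt_mult)
  finally have lower: "sqrt (real I) \<le> real C * (sqrt (real (class_number ?K)) * sqrt (real (class_number G)))" .
  have "class_number G > 0" "class_number ?K > 0"
    using card_Irr K.card_Irr Irr_nonempty K.Irr_nonempty
    by (metis card_gt_0_iff finite_Irr, metis card_gt_0_iff K.finite_Irr)
  then have "1 / (sqrt (real (class_number ?K)) * sqrt (real (class_number G))) * sqrt (real I) \<le> real C"
    using lower by (simp add: divide_le_eq)
  with upper show ?thesis by (simp add: C_def I_def)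
qed

end
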